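(* Let $C_1,\dots,C_n$ be independent first class constraints on $\mathcal{M}$, let $x\in\mathcal{C}$, and let $T_1,\dots,T_n,f\in C^\infty(\mathcal{M})$. Assume that the map $\mathbf{T}_x:\mathcal{G}_x\to\mathbf{T}_x(\mathcal{G}_x)\subset\mathbb{R}^n$, $y\mapsto(T_1(y),\dots,T_n(y))$, is injective on the gauge orbit $\mathcal{G}_x$, and that the matrix $A_{kj}:=\{C_k,T_j\}$ is invertible at every point of $\mathcal{G}_x$, with inverse $A^{-1}$. Then for all $\tau\in\mathbf{T}_x(\mathcal{G}_x)$ and $m=1,\dots,n$ the complete observable $F_{[f,T_i]}(\tau,x)=f(\mathbf{T}_x^{-1}(\tau))$ satisfies $$\frac{\partial}{\partial\tau_m}F_{[f,T_i]}(\tau,x)=\Big(\sum_{k=1}^nA^{-1}_{mk}\{C_k,f\}\Big)(\mathbf{T}_x^{-1}(\tau))=F_{[g_m,T_i]}(\tau,x),\qquad g_m:=\sum_{k=1}^nA^{-1}_{mk}\{C_k,f\}.$$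
   Context: $\mathcal{M}$ is a $2p$-dimensional smooth manifold with a non-degenerate Poisson bracket $\{\cdot,\cdot\}$. The constraints $C_1,\dots,C_n\in C^\infty(\mathcal{M})$, $n<p$, are independent, meaning that the constraint hypersurface $\mathcal{C}=\{C_1=\dots=C_n=0\}$ is a $(2p-n)$-dimensional submanifold, and first class: $\{C_i,C_j\}=\sum_k f_{ijk}C_k$ with $f_{ijk}\in C^\infty(\mathcal{M})$. The Hamiltonian vector field of $C$ is $\chi_C(f)=\{C,f\}$. The gauge orbit $\mathcal{G}_x$ of $x\in\mathcal{C}$ is the set of points reached from $x$ by finite compositions of flows generated by the constraints; it is an $n$-dimensional submanifold of $\mathcal{C}$ whose tangent space at each point is spanned by $\chi_{C_1},\dots,\chi_{C_n}$. For a function $g$ defined on $\mathcal{G}_x$, the complete observable $F_{[g,T_i]}(\tau,x)$ is the value of $g$ at the point $y\in\mathcal{G}_x$ with $T_i(y)=\tau_i$ for $i=1,\dots,n$; under the injectivity assumption this point is unique and denoted $\mathbf{T}_x^{-1}(\tau)$, for $\tau\in\mathbf{T}_x(\mathcal{G}_x)$. *)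

theory Defs
  imports "HOL-Analysis.Analysis"
begin

section \<open>Smooth maps between Euclidean spaces\<close>

text \<open>Meant for open \<open>S\<close> and finite-dimensional domain, where it is the usual notion of a
  \<open>C\<^sup>k\<close> map, expressed through directional derivatives.\<close>

primrec Ck_on :: "nat \<Rightarrow> 'v::real_normed_vector set \<Rightarrow> ('v \<Rightarrow> 'w::real_normed_vector) \<Rightarrow> bool" where
  "Ck_on 0 S f \<longleftrightarrow> continuous_on S f"
| "Ck_on (Suc k) S f \<longleftrightarrow>
     (\<forall>x\<in>S. f differentiable (at x)) \<and> (\<forall>v. Ck_on k S (\<lambda>x. frechet_derivative f (at x) v))"

definition smooth_on :: "'v::real_normed_vector set \<Rightarrow> ('v \<Rightarrow> 'w::real_normed_vector) \<Rightarrow> bool" where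
  "smooth_on S f \<longleftrightarrow> (\<forall>k. Ck_on k S f)"


section \<open>Smooth manifolds\<close>

text \<open>The underlying space of the manifold is a whole type; being Hausdorff and second countable
  is demanded through its type classes. A chart is a pair of a domain and a coordinate map, whose
  values outside the domain are irrelevant.\<close>

type_synonym ('a, 'e) atlas = "('a set \<times> ('a \<Rightarrow> 'e)) set"

definition chart :: "'a::topological_space set \<Rightarrow> ('a \<Rightarrow> 'e::euclidean_space) \<Rightarrow> bool" where
  "chart U \<phi> \<longleftrightarrow> open U \<and> open (\<phi> ` U) \<and> homeomorphism U (\<phi> ` U) \<phi> (inv_into U \<phi>)"

definition compatible ::
  "'a set \<Rightarrow> ('a \<Rightarrow> 'e::euclidean_space) \<Rightarrow> 'a set \<Rightarrow> ('a \<Rightarrow> 'e) \<Rightarrow> bool" where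
  "compatible U \<phi> V \<psi> \<longleftrightarrow>
     smooth_on (\<phi> ` (U \<inter> V)) (\<psi> \<circ> inv_into U \<phi>) \<and> smooth_on (\<psi> ` (U \<inter> V)) (\<phi> \<circ> inv_into V \<psi>)"

definition smooth_atlas ::
  "('a::{t2_space,second_countable_topology}, 'e::euclidean_space) atlas \<Rightarrow> bool" where
  "smooth_atlas \<A> \<longleftrightarrow>
     (\<Union>(U, \<phi>)\<in>\<A>. U) = UNIV \<and>
     (\<forall>(U, \<phi>)\<in>\<A>. chart U \<phi>) \<and>
     (\<forall>(U, \<phi>)\<in>\<A>. \<forall>(V, \<psi>)\<in>\<A>. compatible U \<phi> V \<psi>)"

definition smooth_fun :: "('a, 'e::euclidean_space) atlas \<Rightarrow> ('a \<Rightarrow> real) \<Rightarrow> bool" where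
  "smooth_fun \<A> f \<longleftrightarrow> (\<forall>(U, \<phi>)\<in>\<A>. smooth_on (\<phi> ` U) (f \<circ> inv_into U \<phi>))"

definition differential_zero ::
  "('a, 'e::euclidean_space) atlas \<Rightarrow> ('a \<Rightarrow> real) \<Rightarrow> 'a \<Rightarrow> bool" where
  "differential_zero \<A> f y \<longleftrightarrow>
     (\<forall>(U, \<phi>)\<in>\<A>. y \<in> U \<longrightarrow> ((f \<circ> inv_into U \<phi>) has_derivative (\<lambda>v. 0)) (at (\<phi> y)))"

text \<open>Embedded submanifolds, through slice charts taken from the maximal atlas.\<close>

definition submanifold ::
  "('a::topological_space, 'e::euclidean_space) atlas \<Rightarrow> nat \<Rightarrow> 'a set \<Rightarrow> bool" where
  "submanifold \<A> d S \<longleftrightarrow>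
     (\<forall>y\<in>S. \<exists>U \<phi> L. y \<in> U \<and> chart U \<phi> \<and> (\<forall>(V, \<psi>)\<in>\<A>. compatible U \<phi> V \<psi>) \<and>
        subspace L \<and> dim L = d \<and> \<phi> ` (S \<inter> U) = \<phi> ` U \<inter> L)"


section \<open>Poisson brackets, constraints and gauge orbits\<close>

type_synonym 'a bracket = "('a \<Rightarrow> real) \<Rightarrow> ('a \<Rightarrow> real) \<Rightarrow> 'a \<Rightarrow> real"

text \<open>The values of a bracket on functions that are not smooth are irrelevant. Linearity in the
  second argument follows from antisymmetry.\<close>

definition poisson_bracket ::
  "('a, 'e::euclidean_space) atlas \<Rightarrow> 'a bracket \<Rightarrow> bool" where
  "poisson_bracket \<A> pb \<longleftrightarrow>
     (\<forall>f g. smooth_fun \<A> f \<longrightarrow> smooth_fun \<A> g \<longrightarrow> smooth_fun \<A> (pb f g)) \<and>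
     (\<forall>f g. smooth_fun \<A> f \<longrightarrow> smooth_fun \<A> g \<longrightarrow> pb f g = (\<lambda>y. - pb g f y)) \<and>
     (\<forall>a b f g h. smooth_fun \<A> f \<longrightarrow> smooth_fun \<A> g \<longrightarrow> smooth_fun \<A> h \<longrightarrow>
        pb (\<lambda>y. a * f y + b * g y) h = (\<lambda>y. a * pb f h y + b * pb g h y)) \<and>
     (\<forall>f g h. smooth_fun \<A> f \<longrightarrow> smooth_fun \<A> g \<longrightarrow> smooth_fun \<A> h \<longrightarrow>
        pb f (\<lambda>y. g y * h y) = (\<lambda>y. pb f g y * h y + g y * pb f h y)) \<and>
     (\<forall>f g h. smooth_fun \<A> f \<longrightarrow> smooth_fun \<A> g \<longrightarrow> smooth_fun \<A> h \<longrightarrow>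
        (\<forall>y. pb f (pb g h) y + pb g (pb h f) y + pb h (pb f g) y = 0))"

text \<open>The map sending \<open>df\<close> at \<open>y\<close> to the tangent vector \<open>g \<mapsto> {f, g}(y)\<close> is injective.\<close>

definition nondegenerate :: "('a, 'e::euclidean_space) atlas \<Rightarrow> 'a bracket \<Rightarrow> bool" where
  "nondegenerate \<A> pb \<longleftrightarrow>
     (\<forall>f y. smooth_fun \<A> f \<longrightarrow> (\<forall>g. smooth_fun \<A> g \<longrightarrow> pb f g y = 0) \<longrightarrow>
        differential_zero \<A> f y)"

definition constraint_surface :: "('n \<Rightarrow> 'a \<Rightarrow> real) \<Rightarrow> 'a set" where
  "constraint_surface C = {y. \<forall>i. C i y = 0}"

definition independent_constraints ::
  "('a::topological_space, 'e::euclidean_space) atlas \<Rightarrow> ('n::finite \<Rightarrow> 'a \<Rightarrow> real) \<Rightarrow> bool" where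
  "independent_constraints \<A> C \<longleftrightarrow> submanifold \<A> (DIM('e) - CARD('n)) (constraint_surface C)"

definition first_class ::
  "('a, 'e::euclidean_space) atlas \<Rightarrow> 'a bracket \<Rightarrow> ('n::finite \<Rightarrow> 'a \<Rightarrow> real) \<Rightarrow> bool" where
  "first_class \<A> pb C \<longleftrightarrow>
     (\<exists>F. (\<forall>i j k. smooth_fun \<A> (F i j k)) \<and>
          (\<forall>i j. pb (C i) (C j) = (\<lambda>y. \<Sum>k\<in>UNIV. F i j k y * C k y)))"

text \<open>\<open>\<gamma>\<close> is an integral curve on the interval \<open>I\<close> of the Hamiltonian vector field \<open>f \<mapsto> {H, f}\<close>;
  tangent vectors are read as derivations on smooth functions.\<close>

definition integral_curve ::
  "('a::topological_space, 'e::euclidean_space) atlas \<Rightarrow> 'a bracket \<Rightarrow> ('a \<Rightarrow> real) \<Rightarrow>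
     (real \<Rightarrow> 'a) \<Rightarrow> real set \<Rightarrow> bool" where
  "integral_curve \<A> pb H \<gamma> I \<longleftrightarrow>
     continuous_on I \<gamma> \<and>
     (\<forall>f. smooth_fun \<A> f \<longrightarrow>
        (\<forall>s\<in>I. ((f \<circ> \<gamma>) has_real_derivative pb H f (\<gamma> s)) (at s within I)))"

text \<open>The (possibly only local) flow of \<open>H\<close> at time \<open>t\<close>, of either sign, is defined at \<open>y\<close> and
  takes \<open>y\<close> to \<open>z\<close>.\<close>

definition flow_to ::
  "('a::topological_space, 'e::euclidean_space) atlas \<Rightarrow> 'a bracket \<Rightarrow> ('a \<Rightarrow> real) \<Rightarrow>
     real \<Rightarrow> 'a \<Rightarrow> 'a \<Rightarrow> bool" where
  "flow_to \<A> pb H t y z \<longleftrightarrow>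
     (\<exists>\<gamma>. integral_curve \<A> pb H \<gamma> (closed_segment 0 t) \<and> \<gamma> 0 = y \<and> \<gamma> t = z)"

inductive_set gauge_orbit ::
  "('a::topological_space, 'e::euclidean_space) atlas \<Rightarrow> 'a bracket \<Rightarrow> ('n \<Rightarrow> 'a \<Rightarrow> real) \<Rightarrow>
     'a \<Rightarrow> 'a set"
  for \<A> pb C x where
  base: "x \<in> gauge_orbit \<A> pb C x"
| flow: "y \<in> gauge_orbit \<A> pb C x \<Longrightarrow> flow_to \<A> pb (C i) t y z \<Longrightarrow> z \<in> gauge_orbit \<A> pb C x"


section \<open>Complete observables\<close>

definition clock_map :: "('n::finite \<Rightarrow> 'a \<Rightarrow> real) \<Rightarrow> 'a \<Rightarrow> real ^ 'n" where
  "clock_map T y = (\<chi> i. T i y)"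

definition clock_inverse ::
  "('a::topological_space, 'e::euclidean_space) atlas \<Rightarrow> 'a bracket \<Rightarrow> ('n::finite \<Rightarrow> 'a \<Rightarrow> real) \<Rightarrow>
     ('n \<Rightarrow> 'a \<Rightarrow> real) \<Rightarrow> 'a \<Rightarrow> real ^ 'n \<Rightarrow> 'a" where
  "clock_inverse \<A> pb C T x = inv_into (gauge_orbit \<A> pb C x) (clock_map T)"

definition complete_observable ::
  "('a::topological_space, 'e::euclidean_space) atlas \<Rightarrow> 'a bracket \<Rightarrow> ('n::finite \<Rightarrow> 'a \<Rightarrow> real) \<Rightarrow>
     ('a \<Rightarrow> real) \<Rightarrow> ('n \<Rightarrow> 'a \<Rightarrow> real) \<Rightarrow> real ^ 'n \<Rightarrow> 'a \<Rightarrow> real" where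
  "complete_observable \<A> pb C g T \<tau> x =
     g (THE y. y \<in> gauge_orbit \<A> pb C x \<and> (\<forall>i. T i y = \<tau> $ i))"

definition clock_matrix ::
  "'a bracket \<Rightarrow> ('n::finite \<Rightarrow> 'a \<Rightarrow> real) \<Rightarrow> ('n \<Rightarrow> 'a \<Rightarrow> real) \<Rightarrow> 'a \<Rightarrow> real ^ 'n ^ 'n" where
  "clock_matrix pb C T y = (\<chi> k j. pb (C k) (T j) y)"

definition observable_rate ::
  "'a bracket \<Rightarrow> ('n::finite \<Rightarrow> 'a \<Rightarrow> real) \<Rightarrow> ('n \<Rightarrow> 'a \<Rightarrow> real) \<Rightarrow> ('a \<Rightarrow> real) \<Rightarrow>
     'n \<Rightarrow> 'a \<Rightarrow> real" where
  "observable_rate pb C T f m y =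
     (\<Sum>k\<in>UNIV. matrix_inv (clock_matrix pb C T y) $ m $ k * pb (C k) f y)"

text \<open>The \<open>m\<close>-th partial derivative at \<open>\<tau>\<close> of a function \<open>F\<close> that is meaningful only on \<open>D\<close>. The
  first conjunct makes the derivative independent of the values of \<open>F\<close> outside \<open>D\<close>.\<close>

definition has_partial_derivative ::
  "(real ^ 'n \<Rightarrow> real) \<Rightarrow> (real ^ 'n) set \<Rightarrow> 'n::finite \<Rightarrow> real \<Rightarrow> real ^ 'n \<Rightarrow> bool" where
  "has_partial_derivative F D m d \<tau> \<longleftrightarrow>
     (\<forall>\<^sub>F s in nhds 0. \<tau> + s *\<^sub>R axis m 1 \<in> D) \<and>
     ((\<lambda>s. F (\<tau> + s *\<^sub>R axis m 1)) has_real_derivative d) (at 0)"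

end

theory Submission
  imports Defs
begin

text \<open>
  Let \<open>y\<close> be a point of the orbit. The composition \<open>\<Psi>(t\<^sub>1, \<dots>, t\<^sub>n)\<close> of the flows of all constraints,
  started at \<open>y\<close> and run for the times \<open>t\<^sub>k\<close>, stays in the orbit and satisfies
  \<open>\<partial>/\<partial>t\<^sub>k (g \<circ> \<Psi>)(0) = {C\<^sub>k, g}(y)\<close> for every smooth \<open>g\<close>. Hence \<open>\<T> \<circ> \<Psi>\<close> has the derivative
  \<open>t \<mapsto> t A(y)\<close> at \<open>0\<close>, and since the complete observable \<open>F\<close> satisfies \<open>F \<circ> (\<T> \<circ> \<Psi>) = f \<circ> \<Psi>\<close> by
  injectivity of the clocks, inverting \<open>A(y)\<close> gives the derivative of \<open>F\<close>.

  Continuity of \<open>\<Psi>\<close> near \<open>0\<close> and differentiability at the single point \<open>0\<close> suffice, so the flows are only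
  treated as flows of Lipschitz vector fields; smooth dependence on initial values is not needed.
  That a bracket \<open>{H, \<cdot>}\<close>, given on global functions only, acts in a chart as a smooth vector field
  follows from Hadamard's lemma and bump functions.
\<close>

section \<open>Calculus of continuously differentiable maps\<close>

lemma Ck_on_cong:
  assumes "open S" "\<And>x. x \<in> S \<Longrightarrow> f x = g x" "Ck_on k S f"
  shows "Ck_on k S g"
  using assms(2,3)
proof (induction k arbitrary: f g)
  case 0
  then show ?case using continuous_on_cong[of S S f g] by auto
next
  case (Suc k)
  have D: "(g has_derivative frechet_derivative f (at x)) (at x)" if "x \<in> S" for x
    using Suc.prems that assms(1) frechet_derivative_works
    by (metis Ck_on.simps(2) has_derivative_transform_within_open)
  have "Ck_on k S (\<lambda>x. frechet_derivative g (at x) v)" for v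
  proof (rule Suc.IH)
    show "frechet_derivative f (at x) v = frechet_derivative g (at x) v" if "x \<in> S" for x
      using frechet_derivative_at[OF D[OF that]] by simp
    show "Ck_on k S (\<lambda>x. frechet_derivative f (at x) v)" using Suc.prems(2) by simp
  qed
  with D show ?case by (auto simp: differentiable_def)
qed

text \<open>Induction step of the closure rules below: the derivative may be given by any formula
  \<open>f'\<close>. Derivatives are unique, so \<open>f'\<close> agrees with
  \<open>frechet_derivative\<close> on the open set \<open>S\<close>, and \<open>Ck_on_cong\<close>
  transfers the regularity.\<close>

lemma Ck_on_SucI:
  assumes "open S" "\<And>x. x \<in> S \<Longrightarrow> (f has_derivative f' x) (at x)" "\<And>v. Ck_on k S (\<lambda>x. f' x v)"
  shows "Ck_on (Suc k) S f"
proof -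
  have "Ck_on k S (\<lambda>x. frechet_derivative f (at x) v)" for v
    by (rule Ck_on_cong[OF assms(1) _ assms(3)[of v]]) (simp add: frechet_derivative_at[OF assms(2)])
  then show ?thesis using assms(2) by (auto simp: differentiable_def)
qed

lemma Ck_on_Suc_has_derivative:
  "Ck_on (Suc k) S f \<Longrightarrow> x \<in> S \<Longrightarrow> (f has_derivative frechet_derivative f (at x)) (at x)"
  using frechet_derivative_works by auto

lemma Ck_on_continuous_on: "Ck_on k S f \<Longrightarrow> continuous_on S f"
  by (cases k) (auto simp: continuous_at_imp_continuous_on differentiable_imp_continuous_within)

lemma Ck_on_Suc_imp: "Ck_on (Suc k) S f \<Longrightarrow> Ck_on k S f"
proof (induction k arbitrary: f)
  case 0
  then show ?case using Ck_on_continuous_on[of "Suc 0" S f] by simp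
next
  case (Suc k)
  then show ?case by (simp del: Ck_on.simps add: Ck_on.simps(2)[of _ S f])
qed

lemma Ck_on_subset: "Ck_on k S f \<Longrightarrow> S' \<subseteq> S \<Longrightarrow> Ck_on k S' f"
  by (induction k arbitrary: f) (auto intro: continuous_on_subset)

lemma Ck_on_Un:
  "open S \<Longrightarrow> open S' \<Longrightarrow> Ck_on k S f \<Longrightarrow> Ck_on k S' f \<Longrightarrow> Ck_on k (S \<union> S') f"
  by (induction k arbitrary: f) (auto intro: continuous_on_open_Un)

lemma Ck_on_const: "open S \<Longrightarrow> Ck_on k S (\<lambda>x. c)"
  by (induction k arbitrary: c)
    (auto intro!: Ck_on_SucI[where f' = "\<lambda>x v. 0"] simp del: Ck_on.simps(2))

lemma Ck_on_bounded_linear: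
  assumes "open S" "bounded_linear h" shows "Ck_on k S h"
proof (cases k)
  case 0
  then show ?thesis using assms(2) by (simp add: linear_continuous_on)
next
  case (Suc k)
  show ?thesis unfolding Suc
    by (rule Ck_on_SucI[where f' = "\<lambda>x. h"])
      (use assms in \<open>auto intro: Ck_on_const bounded_linear_imp_has_derivative\<close>)
qed

lemma Ck_on_bounded_linear_compose:
  assumes "open S" "bounded_linear h" "Ck_on k S f"
  shows "Ck_on k S (\<lambda>x. h (f x))"
  using assms(3)
proof (induction k arbitrary: f)
  case 0
  then show ?case using assms(2) by (simp add: bounded_linear.continuous_on)
next
  case (Suc k)
  show ?case
    by (rule Ck_on_SucI[OF assms(1) bounded_linear.has_derivative[OF assms(2)
            Ck_on_Suc_has_derivative[OF Suc.prems]]])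
      (use Suc in auto)
qed

section \<open>Sums, products, inverses and compositions of C^k maps\<close>

lemma Ck_on_add:
  assumes "open S" "Ck_on k S f" "Ck_on k S g"
  shows "Ck_on k S (\<lambda>x. f x + g x)"
  using assms(2,3)
proof (induction k arbitrary: f g)
  case 0
  then show ?case by (simp add: continuous_on_add)
next
  case (Suc k)
  show ?case
    by (rule Ck_on_SucI[OF assms(1) has_derivative_add[OF
          Ck_on_Suc_has_derivative[OF Suc.prems(1)] Ck_on_Suc_has_derivative[OF Suc.prems(2)]]])
      (use Suc in auto)
qed

lemma Ck_on_sum:
  "open S \<Longrightarrow> (\<And>i. i \<in> I \<Longrightarrow> Ck_on k S (f i)) \<Longrightarrow> Ck_on k S (\<lambda>x. \<Sum>i\<in>I. f i x)"
  by (induction I rule: infinite_finite_induct) (auto intro: Ck_on_const Ck_on_add)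

lemma Ck_on_scaleR:
  fixes a :: "'v::real_normed_vector \<Rightarrow> real"
  assumes "open S" "Ck_on k S a" "Ck_on k S f"
  shows "Ck_on k S (\<lambda>x. a x *\<^sub>R f x)"
  using assms(2,3)
proof (induction k arbitrary: a f)
  case 0
  then show ?case by (simp add: continuous_on_scaleR)
next
  case (Suc k)
  show ?case
  proof (rule Ck_on_SucI[OF assms(1) has_derivative_scaleR[OF
          Ck_on_Suc_has_derivative[OF Suc.prems(1)] Ck_on_Suc_has_derivative[OF Suc.prems(2)]]])
    show "Ck_on k S (\<lambda>x. a x *\<^sub>R frechet_derivative f (at x) v
        + frechet_derivative a (at x) v *\<^sub>R f x)" for v
      by (intro Ck_on_add Suc.IH assms(1) Suc.prems(1)[THEN Ck_on_Suc_imp]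
          Suc.prems(2)[THEN Ck_on_Suc_imp]) (use Suc.prems in auto)
  qed
qed

lemma Ck_on_mult:
  fixes a f :: "'v::real_normed_vector \<Rightarrow> real"
  shows "open S \<Longrightarrow> Ck_on k S a \<Longrightarrow> Ck_on k S f \<Longrightarrow> Ck_on k S (\<lambda>x. a x * f x)"
  using Ck_on_scaleR[of S k a f] by simp

lemma Ck_on_inverse:
  fixes f :: "'v::real_normed_vector \<Rightarrow> real"
  assumes "open S" "Ck_on k S f" "\<And>x. x \<in> S \<Longrightarrow> f x \<noteq> 0"
  shows "Ck_on k S (\<lambda>x. inverse (f x))"
  using assms(2,3)
proof (induction k arbitrary: f)
  case 0
  then show ?case by (simp add: continuous_on_inverse)
next
  case (Suc k)
  have 1: "Ck_on k S (\<lambda>x. inverse (f x))"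
    using Suc.IH[OF Ck_on_Suc_imp[OF Suc.prems(1)] Suc.prems(2)] .
  have "Ck_on k S (\<lambda>x. -1 * (inverse (f x) * frechet_derivative f (at x) v * inverse (f x)))" for v
    using 1 Suc.prems(1) by (intro Ck_on_mult Ck_on_const assms(1)) auto
  then show ?case
    by (intro Ck_on_SucI[OF assms(1) Deriv.has_derivative_inverse[OF Suc.prems(2)
          Ck_on_Suc_has_derivative[OF Suc.prems(1)]]]) auto
qed

lemma Ck_on_compose:
  fixes q :: "'u::real_normed_vector \<Rightarrow> 'v::euclidean_space"
  assumes "open S" "q ` S \<subseteq> S'" "Ck_on k S' g" "Ck_on k S q"
  shows "Ck_on k S (\<lambda>x. g (q x))"
  using assms(3,4)
proof (induction k arbitrary: g)
  case 0
  then show ?case using assms(2) by (auto intro: continuous_on_compose2)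
next
  case (Suc k)
  let ?g = "\<lambda>y. frechet_derivative g (at y)" and ?q = "\<lambda>x. frechet_derivative q (at x)"
  have D: "((\<lambda>x. g (q x)) has_derivative (\<lambda>v. ?g (q x) (?q x v))) (at x)" if "x \<in> S" for x
    using has_derivative_compose[OF Ck_on_Suc_has_derivative[OF Suc.prems(2) that]
        Ck_on_Suc_has_derivative[OF Suc.prems(1), of "q x"]] assms(2) that by auto
  \<comment> \<open>In the chain rule the direction \<open>?q x v\<close> moves with
    \<open>x\<close>, while \<open>Ck_on\<close> controls derivatives of \<open>g\<close> in fixed
    directions only. Expanding it in \<open>Basis\<close> leaves fixed directions with C^k
    coefficients.\<close>
  have E: "?g (q x) (?q x v) = (\<Sum>b\<in>Basis. (?q x v \<bullet> b) *\<^sub>R ?g (q x) b)" if "x \<in> S" for x v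
  proof -
    have "bounded_linear (?g (q x))"
      using Ck_on_Suc_has_derivative[OF Suc.prems(1), of "q x"] assms(2) that
      by (auto intro: has_derivative_bounded_linear)
    then have "linear (?g (q x))" by (rule bounded_linear.linear)
    then show ?thesis
      using linear_sum linear_scale euclidean_representation[of "?q x v"]
      by (smt (verit) sum.cong)
  qed
  have "Ck_on k S (\<lambda>x. \<Sum>b\<in>Basis. (?q x v \<bullet> b) *\<^sub>R ?g (q x) b)" for v
  proof (intro Ck_on_sum Ck_on_scaleR assms(1))
    fix b :: 'v
    show "Ck_on k S (\<lambda>x. ?g (q x) b)"
      using Suc.IH[of "\<lambda>y. ?g y b"] Suc.prems Ck_on_Suc_imp by auto
    show "Ck_on k S (\<lambda>x. ?q x v \<bullet> b)"
      using Suc.prems(2) by (intro Ck_on_bounded_linear_compose[OF assms(1) bounded_linear_inner_left]) auto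
  qed
  then have "Ck_on k S (\<lambda>x. ?g (q x) (?q x v))" for v
    by (rule Ck_on_cong[OF assms(1), rotated]) (rule E[symmetric])
  then show ?case
    by (intro Ck_on_SucI[OF assms(1) D])
qed

section \<open>Flat functions and the lemma of Hadamard\<close>

text \<open>The classical function exp(-1/s) divided by s^n. The parameter \<open>n\<close> makes
  the family closed under differentiation up to linear combinations, so smoothness follows by
  induction for all \<open>n\<close> at once.\<close>

definition flat :: "nat \<Rightarrow> real \<Rightarrow> real" where
  "flat n s = (if s > 0 then exp (- 1 / s) / s ^ n else 0)"

text \<open>With m = n + 2, (1/(s m))^m \<le> (1 + 1/(s m))^m \<le> exp(1/s) gives exp(-1/s) \<le>
  (s m)^m. Division by s^n leaves s^2, one power more than continuity at 0 requires, so the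
  difference quotient at 0 also tends to 0.\<close>

lemma flat_bound: "\<bar>flat n s\<bar> \<le> real (n + 2) ^ (n + 2) * s\<^sup>2"
proof (cases "s > 0")
  case True
  define m where "m = n + 2"
  have m: "real m > 0" by (simp add: m_def)
  have "(1 / (s * m)) ^ m \<le> (1 + 1 / s / m) ^ m"
    using True m by (intro power_mono) auto
  also have "\<dots> \<le> exp (1 / s)"
    using True m by (intro exp_ge_one_plus_x_over_n_power_n) (auto intro: order_trans[of _ 0])
  finally have "inverse (exp (1 / s)) \<le> inverse ((1 / (s * m)) ^ m)"
    using True m by (intro le_imp_inverse_le) auto
  also have "\<dots> = (s * real (n + 2)) ^ (n + 2)"
    by (simp add: m_def power_one_over inverse_eq_divide del: power_Suc)
  finally have "exp (- 1 / s) \<le> (s * real (n + 2)) ^ (n + 2)"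
    by (simp add: exp_minus)
  then have "exp (- 1 / s) / s ^ n \<le> (s * real (n + 2)) ^ (n + 2) / s ^ n"
    using True by (intro divide_right_mono) auto
  also have "\<dots> = real (n + 2) ^ (n + 2) * s\<^sup>2"
    using True by (simp add: power_mult_distrib power_add power2_eq_square del: of_nat_add)
  finally show ?thesis using True by (simp add: flat_def)
next
  case False
  then show ?thesis by (simp add: flat_def)
qed

lemma flat_has_real_derivative:
  "(flat n has_real_derivative flat (n + 2) s - real n * flat (n + 1) s) (at s)"
proof -
  consider "s > 0" | "s < 0" | "s = 0" by linarith
  then show ?thesis
  proof cases
    case 1
    have "((\<lambda>s. exp (- 1 / s) / s ^ n) has_real_derivative flat (n + 2) s - real n * flat (n + 1) s) (at s)"
    proof (rule DERIV_cong[OF DERIV_divide])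
      show "((\<lambda>s. exp (- 1 / s)) has_real_derivative exp (- 1 / s) / s\<^sup>2) (at s)"
        using 1 by (auto intro!: derivative_eq_intros simp: power2_eq_square)
      show "((\<lambda>s. s ^ n) has_real_derivative real n * s ^ n / s) (at s)"
        using DERIV_pow[of n s UNIV] 1 by (cases n) auto
      \<comment> \<open>The power \<open>s ^ n\<close> is abstracted to a positive \<open>q\<close>,
        which leaves a rational identity in \<open>s\<close>, \<open>q\<close> and
        \<open>e\<close>.\<close>
      have "e / (q * s * s) - real n * (e / (q * s)) = (e / s\<^sup>2 * q - e * (real n * q / s)) / (q * q)"
        if "q > 0" for e q :: real
        using 1 that by (simp add: divide_simps power2_eq_square) (simp add: algebra_simps)
      from this[of "s ^ n" "exp (- 1 / s)"]
      show "(exp (- 1 / s) / s\<^sup>2 * s ^ n - exp (- 1 / s) * (real n * s ^ n / s)) / (s ^ n * s ^ n) =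
          flat (n + 2) s - real n * flat (n + 1) s"
        using 1 by (simp add: flat_def mult_ac)
    qed (use 1 in auto)
    then show ?thesis
      by (rule has_field_derivative_transform_within_open[of _ _ _ "{0<..}"])
        (use 1 in \<open>auto simp: flat_def\<close>)
  next
    case 2
    have "((\<lambda>s. 0) has_real_derivative flat (n + 2) s - real n * flat (n + 1) s) (at s)"
      using 2 by (simp add: flat_def)
    then show ?thesis
      by (rule has_field_derivative_transform_within_open[of _ _ _ "{..<0}"])
        (use 2 in \<open>auto simp: flat_def\<close>)
  next
    case 3
    have "((\<lambda>h. flat n h / h) \<longlongrightarrow> 0) (at 0)"
    proof (rule Lim_null_comparison)
      show "\<forall>\<^sub>F h in at 0. norm (flat n h / h) \<le> real (n + 2) ^ (n + 2) * \<bar>h\<bar>"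
        unfolding eventually_at_filter
      proof (intro always_eventually allI impI)
        fix h :: real assume "h \<noteq> 0"
        then show "norm (flat n h / h) \<le> real (n + 2) ^ (n + 2) * \<bar>h\<bar>"
          using flat_bound[of n h]
          by (simp add: divide_le_eq power2_eq_square mult.assoc abs_mult_self_eq)
      qed
      show "((\<lambda>h. real (n + 2) ^ (n + 2) * \<bar>h\<bar>) \<longlongrightarrow> 0) (at 0)"
        by (rule tendsto_eq_intros refl | simp)+
    qed
    then show ?thesis using 3 by (simp add: has_field_derivative_iff flat_def)
  qed
qed

lemma Ck_on_flat: "Ck_on k UNIV (flat n)"
proof (induction k arbitrary: n)
  case 0
  then show ?case
    using flat_has_real_derivative by (auto intro: continuous_at_imp_continuous_on DERIV_isCont)
next
  case (Suc k)
  have "Ck_on k UNIV (\<lambda>s. (flat (n + 2) s + (- real n) * flat (n + 1) s) * v)" for v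
    by (intro Ck_on_mult Ck_on_add Ck_on_const Suc) auto
  then show ?case
    by (intro Ck_on_SucI[where f' = "\<lambda>s v. (flat (n + 2) s - real n * flat (n + 1) s) * v"]
        flat_has_real_derivative[unfolded has_field_derivative_def]) auto
qed

text \<open>The weight \<open>w\<close> makes the induction work: differentiating in \<open>x\<close> turns \<open>w t\<close> into \<open>w t * t\<close>.\<close>

lemma Ck_on_segment_integral:
  fixes g :: "'v::euclidean_space \<Rightarrow> real"
  assumes "open S" "convex S" "c \<in> S"
    and "\<And>k. Ck_on k S g" "continuous_on {0..1} w"
  shows "Ck_on k S (\<lambda>x. integral {0..1} (\<lambda>t. w t * g (c + t *\<^sub>R (x - c))))"
  using assms(4,5)
proof (induction k arbitrary: g w)
  have seg: "c + t *\<^sub>R (x - c) \<in> S" if "x \<in> S" "t \<in> {0..1}" for x t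
    using convexD_alt[OF assms(2,3) that(1), of t] that(2) by (simp add: algebra_simps)
  have cont: "continuous_on (S \<times> {0..1}) (\<lambda>z. w (snd z) * g (c + snd z *\<^sub>R (fst z - c)))"
    if "continuous_on S g" "continuous_on {0..1} w" for g :: "'v \<Rightarrow> real" and w
    by (intro continuous_intros continuous_on_compose2[OF that(1)] continuous_on_compose2[OF that(2)])
      (auto intro: seg)
  {
    case 0
    then show ?case
      using integral_continuous_on_param[of S 0 "1::real" "\<lambda>x t. w t * g (c + t *\<^sub>R (x - c))"]
        cont[OF Ck_on_continuous_on[OF 0(1)] 0(2)]
      by (simp add: case_prod_unfold)
  next
    case (Suc k)
    let ?D = "\<lambda>x. frechet_derivative g (at x)"
    \<comment> \<open>The Leibniz rule for parameter integrals asks for a derivative that is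
      continuous as a bounded operator. Continuity of \<open>B\<close> is then checked on basis
      directions, where it reduces to \<open>cont\<close>.\<close>
    define B where "B x t = Blinfun (\<lambda>v. (w t * t) * ?D (c + t *\<^sub>R (x - c)) v)" for x t
    have gD: "(g has_derivative ?D x) (at x)" if "x \<in> S" for x
      using Ck_on_Suc_has_derivative[OF Suc.prems(1) that] .
    have B: "blinfun_apply (B x t) = (\<lambda>v. (w t * t) * ?D (c + t *\<^sub>R (x - c)) v)"
      if "x \<in> S" "t \<in> {0..1}" for x t
      unfolding B_def using has_derivative_bounded_linear[OF gD[OF seg[OF that]]]
      by (intro bounded_linear_Blinfun_apply bounded_linear_const_mult)
    have D: "((\<lambda>x. w t * g (c + t *\<^sub>R (x - c))) has_derivative B x t) (at x within S)"
      if "x \<in> S" "t \<in> {0..1}" for x t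
    proof -
      have lin: "linear (?D (c + t *\<^sub>R (x - c)))"
        using has_derivative_linear[OF gD[OF seg[OF that]]] .
      have "((\<lambda>x. c + t *\<^sub>R (x - c)) has_derivative (\<lambda>v. t *\<^sub>R v)) (at x)"
        by (rule derivative_eq_intros refl | simp)+
      from has_derivative_compose[OF this gD[OF seg[OF that]]]
      have "((\<lambda>x. w t * g (c + t *\<^sub>R (x - c))) has_derivative
          (\<lambda>v. w t * ?D (c + t *\<^sub>R (x - c)) (t *\<^sub>R v))) (at x)"
        by (rule has_derivative_mult_right)
      then show ?thesis
        by (rule has_derivative_at_withinI[THEN has_derivative_eq_rhs]) (simp add: B[OF that] linear_scale[OF lin] mult.assoc)
    qed
    have DC: "Ck_on k S (\<lambda>x. ?D x v)" for k v
      using Suc.prems(1)[of "Suc k"] by simp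
    have wc: "continuous_on {0..1} (\<lambda>t. w t * t)"
      using Suc.prems(2) by (intro continuous_intros)
    have Bc: "continuous_on (S \<times> {0..1}) (\<lambda>(x, t). B x t)"
    proof (rule continuous_on_blinfun_componentwise)
      fix i :: 'v
      show "continuous_on (S \<times> {0..1}) (\<lambda>z. (case z of (x, t) \<Rightarrow> B x t) i)"
        by (rule continuous_on_eq[OF cont[OF Ck_on_continuous_on[OF DC[of 0 i]] wc]])
          (auto simp: B)
    qed
    then have Bc': "continuous_on (S \<times> cbox 0 1) (\<lambda>(x, t). B x t)" by simp
    have gc: "continuous_on S g" using Ck_on_continuous_on[OF Suc.prems(1)[of 0]] .
    have cint: "(\<lambda>t. B x t) integrable_on {0..1}" if "x \<in> S" for x
    proof -
      have "continuous_on {0..1} (\<lambda>t::real. (x, t))" by (intro continuous_intros)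
      from continuous_on_compose2[OF Bc this] that show ?thesis
        by (intro integrable_continuous_interval) auto
    qed
    have I: "((\<lambda>x. integral {0..1} (\<lambda>t. w t * g (c + t *\<^sub>R (x - c)))) has_derivative
        integral {0..1} (B x)) (at x)" if "x \<in> S" for x
    proof -
      have "((\<lambda>x. integral (cbox 0 1) (\<lambda>t. w t * g (c + t *\<^sub>R (x - c)))) has_derivative
        integral (cbox 0 1) (B x)) (at x within S)"
      proof (rule leibniz_rule[OF _ _ Bc' that assms(2)])
        show "((\<lambda>x. w t * g (c + t *\<^sub>R (x - c))) has_derivative B x t) (at x within S)"
          if "x \<in> S" "t \<in> cbox 0 1" for x t using D[of x t] that by simp
        show "(\<lambda>t. w t * g (c + t *\<^sub>R (x - c))) integrable_on cbox 0 1" if "x \<in> S" for x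
        proof -
          have "continuous_on {0..1} (\<lambda>t::real. (x, t))" by (intro continuous_intros)
          from continuous_on_compose2[OF cont[OF gc Suc.prems(2)] this] that show ?thesis
            by (auto intro!: integrable_continuous_interval)
        qed
      qed
      then show ?thesis unfolding cbox_interval at_within_open[OF that assms(1)] .
    qed
    have E: "integral {0..1} (\<lambda>t. (w t * t) * ?D (c + t *\<^sub>R (x - c)) v) = blinfun_apply (integral {0..1} (B x)) v"
      if "x \<in> S" for x v
    proof -
      \<comment> \<open>Evaluation at \<open>v\<close> is bounded linear in the operator, hence
        commutes with the integral.\<close>
      have "integral {0..1} ((\<lambda>b. blinfun_apply b v) \<circ> B x) = blinfun_apply (integral {0..1} (B x)) v"
        by (rule integral_linear[OF cint[OF that]]) (rule blinfun.bounded_linear_left)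
      moreover have "integral {0..1} ((\<lambda>b. blinfun_apply b v) \<circ> B x) =
          integral {0..1} (\<lambda>t. (w t * t) * ?D (c + t *\<^sub>R (x - c)) v)"
        by (rule integral_cong) (simp add: B[OF that])
      ultimately show ?thesis by simp
    qed
    have "Ck_on k S (\<lambda>x. integral {0..1} (\<lambda>t. (w t * t) * ?D (c + t *\<^sub>R (x - c)) v))" for v
      by (rule Suc.IH[OF DC wc])
    then have "Ck_on k S (\<lambda>x. blinfun_apply (integral {0..1} (B x)) v)" for v
      by (rule Ck_on_cong[OF assms(1), rotated]) (rule E)
    then show ?case
      by (intro Ck_on_SucI[OF assms(1) I])
  }
qed

text \<open>The coefficient \<open>h b\<close> is the mean of the derivative in direction
  \<open>b\<close> along the segment from \<open>c\<close> to \<open>x\<close>; the fundamental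
  theorem of calculus on that segment gives the expansion. At \<open>x = c\<close> the integrand is
  constant.\<close>

lemma Hadamard:
  fixes g :: "'v::euclidean_space \<Rightarrow> real"
  assumes "open S" "convex S" "c \<in> S" "smooth_on S g"
  obtains h where "\<And>b. smooth_on S (h b)"
    "\<And>x. x \<in> S \<Longrightarrow> g x = g c + (\<Sum>b\<in>Basis. ((x - c) \<bullet> b) * h b x)"
    "\<And>b. h b c = frechet_derivative g (at c) b"
proof -
  let ?D = "\<lambda>x. frechet_derivative g (at x)"
  define h where "h b x = integral {0..1} (\<lambda>t. 1 * ?D (c + t *\<^sub>R (x - c)) b)" for b x
  have DC: "Ck_on k S (\<lambda>x. ?D x b)" for k b
    using assms(4) unfolding smooth_on_def by (metis Ck_on.simps(2))
  have seg: "c + t *\<^sub>R (x - c) \<in> S" if "x \<in> S" "t \<in> {0..1}" for x t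
    using convexD_alt[OF assms(2,3) that(1), of t] that(2) by (simp add: algebra_simps)
  have gD: "(g has_derivative ?D x) (at x)" if "x \<in> S" for x
    using assms(4) that Ck_on_Suc_has_derivative unfolding smooth_on_def by blast
  have "smooth_on S (h b)" for b
    unfolding smooth_on_def h_def
    using Ck_on_segment_integral[OF assms(1-3) DC continuous_on_const[of _ 1]] by blast
  moreover have "g x = g c + (\<Sum>b\<in>Basis. ((x - c) \<bullet> b) * h b x)" if x: "x \<in> S" for x
  proof -
    have lin: "?D (c + t *\<^sub>R (x - c)) (x - c) =
        (\<Sum>b\<in>Basis. ((x - c) \<bullet> b) * ?D (c + t *\<^sub>R (x - c)) b)" if "t \<in> {0..1}" for t
      using has_derivative_linear[OF gD[OF seg[OF x that]]]
      by (subst (2) euclidean_representation[of "x - c", symmetric])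
        (simp only: linear_sum linear_scale real_scaleR_def)
    have int: "(\<lambda>t. ?D (c + t *\<^sub>R (x - c)) b) integrable_on {0..1}" for b
      using seg[OF x]
      by (intro integrable_continuous_interval
          continuous_on_compose2[OF Ck_on_continuous_on[OF DC[of 0 b]]])
        (auto intro!: continuous_intros)
    have "((\<lambda>t. ?D (c + t *\<^sub>R (x - c)) (x - c)) has_integral
        g (c + 1 *\<^sub>R (x - c)) - g (c + 0 *\<^sub>R (x - c))) {0..1}"
    proof (rule fundamental_theorem_of_calculus)
      fix t :: real assume t: "t \<in> {0..1}"
      have "((\<lambda>t. c + t *\<^sub>R (x - c)) has_vector_derivative (x - c)) (at t within {0..1})"
        by (auto intro!: derivative_eq_intros)
      from vector_derivative_diff_chain_within[OF this has_derivative_at_withinI[OF gD[OF seg[OF x t]]]]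
      show "((\<lambda>t. g (c + t *\<^sub>R (x - c))) has_vector_derivative ?D (c + t *\<^sub>R (x - c)) (x - c))
          (at t within {0..1})" by (simp add: o_def)
    qed simp
    then have "g x - g c = integral {0..1} (\<lambda>t. ?D (c + t *\<^sub>R (x - c)) (x - c))"
      by (simp add: integral_unique)
    also have "\<dots> = integral {0..1} (\<lambda>t. \<Sum>b\<in>Basis. ((x - c) \<bullet> b) * ?D (c + t *\<^sub>R (x - c)) b)"
      by (rule integral_cong) (rule lin)
    also have "\<dots> = (\<Sum>b\<in>Basis. ((x - c) \<bullet> b) * h b x)"
      using int by (subst integral_sum) (auto simp: h_def integrable_on_mult_right)
    finally show ?thesis by simp
  qed
  moreover have "h b c = ?D c b" for b by (simp add: h_def)
  ultimately show ?thesis using that by blast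
qed

section \<open>Flows of Lipschitz vector fields\<close>

lemma has_derivative_at_quadratic:
  fixes f :: "'a::real_normed_vector \<Rightarrow> 'b::real_normed_vector"
  assumes "bounded_linear f'" "d > 0"
    and "\<And>h. norm h < d \<Longrightarrow> norm (f (x + h) - f x - f' h) \<le> K * (norm h)\<^sup>2"
  shows "(f has_derivative f') (at x)"
proof -
  have "((\<lambda>h. norm (f (x + h) - f x - f' h) / norm h) \<longlongrightarrow> 0) (at 0)"
  proof (rule Lim_null_comparison)
    show "\<forall>\<^sub>F h in at 0. norm (norm (f (x + h) - f x - f' h) / norm h) \<le> K * norm h"
      unfolding eventually_at
    proof (intro exI conjI ballI impI)
      fix h :: 'a assume h: "h \<noteq> 0 \<and> dist h 0 < d"
      then have "norm (f (x + h) - f x - f' h) \<le> K * norm h * norm h"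
        using assms(3)[of h] by (simp add: power2_eq_square mult.assoc)
      then show "norm (norm (f (x + h) - f x - f' h) / norm h) \<le> K * norm h"
        using h by (simp add: pos_divide_le_eq)
    qed (rule assms(2))
    show "((\<lambda>h. K * norm h) \<longlongrightarrow> 0) (at 0)"
      by (intro tendsto_mult_right_zero tendsto_norm_zero tendsto_ident_at)
  qed
  with assms(1) show ?thesis by (simp add: has_derivative_at)
qed

section \<open>Integral curves and their dependence on the initial value\<close>

lemma has_vector_derivative_bound:
  fixes f :: "real \<Rightarrow> 'e::real_normed_vector"
  assumes "\<And>t. \<bar>t\<bar> \<le> a \<Longrightarrow> (f has_vector_derivative f' t) (at t within {-a..a})"
    and "\<And>t. \<bar>t\<bar> \<le> a \<Longrightarrow> norm (f' t) \<le> M" "\<bar>s\<bar> \<le> a" "\<bar>t\<bar> \<le> a"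
  shows "norm (f t - f s) \<le> M * \<bar>t - s\<bar>"
proof -
  have "norm (f t - f s) \<le> M * norm (t - s)"
  proof (rule differentiable_bound)
    show "(f has_derivative (\<lambda>h. h *\<^sub>R f' r)) (at r within {-a..a})" if "r \<in> {-a..a}" for r
      using assms(1)[of r] that by (auto simp: has_vector_derivative_def)
    show "onorm (\<lambda>h. h *\<^sub>R f' r) \<le> M" if "r \<in> {-a..a}" for r
    proof (rule onorm_le)
      show "norm (h *\<^sub>R f' r) \<le> M * norm h" for h :: real
        using mult_right_mono[OF assms(2)[of r], of "\<bar>h\<bar>"] that by (auto simp: mult.commute)
    qed
  qed (use assms(3,4) in auto)
  then show ?thesis by simp
qed

lemma has_vector_derivative_imp_continuous_on:
  assumes "\<And>t. \<bar>t\<bar> \<le> a \<Longrightarrow> (f has_vector_derivative f' t) (at t within {-a..a})"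
  shows "continuous_on {-a..a} f"
  unfolding continuous_on_eq_continuous_within
  by (intro ballI has_vector_derivative_continuous[OF assms]) auto

text \<open>Picard iteration as a Banach fixed point: \<open>a * L \<le> 1 / 2\<close> makes the
  integral operator a contraction with factor 1/2 in the supremum norm.\<close>

lemma lipschitz_ode_solution:
  fixes X :: "'e::euclidean_space \<Rightarrow> 'e"
  assumes lip: "L-lipschitz_on UNIV X" and bd: "\<And>x. norm (X x) \<le> B" and a: "a > 0" "a * L \<le> 1 / 2"
  obtains u where "u 0 = z"
    "\<And>t. \<bar>t\<bar> \<le> a \<Longrightarrow> (u has_vector_derivative X (u t)) (at t within {-a..a})"
proof -
  \<comment> \<open>The primitive of \<open>g\<close> vanishing at 0. A difference of integrals from
    \<open>-a\<close> covers negative times as well.\<close>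
  define I where "I g t = integral {-a..t} g - integral {-a..0} g" for g :: "real \<Rightarrow> 'e" and t
  have I0: "I g 0 = 0" for g by (simp add: I_def)
  have ID: "(I g has_vector_derivative g t) (at t within {-a..a})"
    if "continuous_on UNIV g" "\<bar>t\<bar> \<le> a" for g t
  proof -
    have "((\<lambda>t. integral {-a..t} g - integral {-a..0} g) has_vector_derivative g t - 0) (at t within {-a..a})"
      by (intro has_vector_derivative_diff integral_has_vector_derivative has_vector_derivative_const
          continuous_on_subset[OF that(1)]) (use that(2) in auto)
    then show ?thesis by (simp add: I_def[abs_def])
  qed
  \<comment> \<open>Clamping time to [-a, a] makes the Picard operator act on bounded continuous
    functions on the whole line, a complete space; on [-a, a] itself the clamp is the
    identity.\<close>
  define c where "c t = max (-a) (min a t)" for t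
  have c: "\<bar>c t\<bar> \<le> a" for t using a(1) by (auto simp: c_def)
  have cI: "c t \<in> {-a..a}" for t using c[of t] by (simp add: abs_le_iff)
  have cc: "continuous_on UNIV c" unfolding c_def by (intro continuous_intros)
  have Xc: "continuous_on UNIV X" using lip by (rule lipschitz_on_continuous_on)
  have Ic: "continuous_on UNIV (\<lambda>t. z + I g (c t))" if "continuous_on UNIV g" for g
  proof -
    have "continuous_on {-a..a} (I g)"
      by (rule has_vector_derivative_imp_continuous_on) (rule ID[OF that])
    then have "continuous_on UNIV (\<lambda>t. I g (c t))"
      by (rule continuous_on_compose2[OF _ cc]) (use cI in auto)
    then show ?thesis by (intro continuous_intros)
  qed
  have Ib: "norm (z + I (\<lambda>s. X (u s)) (c t)) \<le> norm z + B * a" if "continuous_on UNIV u" for u t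
  proof -
    have "norm (I (\<lambda>s. X (u s)) (c t) - I (\<lambda>s. X (u s)) 0) \<le> B * \<bar>c t - 0\<bar>"
    proof (rule has_vector_derivative_bound)
      show "(I (\<lambda>s. X (u s)) has_vector_derivative X (u s)) (at s within {-a..a})" if "\<bar>s\<bar> \<le> a" for s
        by (rule ID[OF continuous_on_compose2[OF Xc \<open>continuous_on UNIV u\<close>] that]) simp
    qed (use a bd c in auto)
    also have "\<dots> \<le> B * a"
      using c[of t] order_trans[OF norm_ge_zero bd[of 0]] by (intro mult_left_mono) auto
    finally show ?thesis using norm_triangle_ineq[of z "I (\<lambda>s. X (u s)) (c t)"] by (simp add: I0)
  qed
  define P where "P u = Bcontfun (\<lambda>t. z + I (\<lambda>s. X (apply_bcontfun u s)) (c t))" for u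
  have P: "apply_bcontfun (P u) = (\<lambda>t. z + I (\<lambda>s. X (apply_bcontfun u s)) (c t))" for u
    unfolding P_def
  proof (rule Bcontfun_inverse, rule bcontfun_normI)
    have u: "continuous_on UNIV (apply_bcontfun u)" using apply_bcontfun[of u] by (simp add: bcontfun_def)
    show "continuous_on UNIV (\<lambda>t. z + I (\<lambda>s. X (apply_bcontfun u s)) (c t))"
      by (rule Ic[OF continuous_on_compose2[OF Xc u]]) simp
    show "norm (z + I (\<lambda>s. X (apply_bcontfun u s)) (c t)) \<le> norm z + B * a" for t
      by (rule Ib[OF u])
  qed
  have "\<exists>!u. P u = u"
  proof (rule banach_fix_type[of "1 / 2"], safe)
    fix u v :: "real \<Rightarrow>\<^sub>C 'e"
    show "dist (P u) (P v) \<le> 1 / 2 * dist u v"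
    proof (rule dist_bound)
      fix t
      have uv: "continuous_on UNIV (\<lambda>s. X (apply_bcontfun u s))" for u
        using apply_bcontfun[of u] by (intro continuous_on_compose2[OF Xc]) (auto simp: bcontfun_def)
      let ?w = "\<lambda>t. I (\<lambda>s. X (apply_bcontfun u s)) t - I (\<lambda>s. X (apply_bcontfun v s)) t"
      have "norm (?w (c t) - ?w 0) \<le> (L * dist u v) * \<bar>c t - 0\<bar>"
      proof (rule has_vector_derivative_bound)
        show "(?w has_vector_derivative X (apply_bcontfun u s) - X (apply_bcontfun v s))
          (at s within {-a..a})" if "\<bar>s\<bar> \<le> a" for s
          by (intro has_vector_derivative_diff ID uv that)
        show "norm (X (apply_bcontfun u s) - X (apply_bcontfun v s)) \<le> L * dist u v" for s
          using lipschitz_onD[OF lip, of "apply_bcontfun u s" "apply_bcontfun v s"]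
            mult_left_mono[OF dist_bounded[of u s v] lipschitz_on_nonneg[OF lip]]
          by (simp add: dist_norm)
      qed (use c a in auto)
      also have "\<dots> \<le> (L * dist u v) * a"
        using c[of t] lipschitz_on_nonneg[OF lip] by (intro mult_left_mono) auto
      also have "\<dots> = (a * L) * dist u v" by simp
      also have "\<dots> \<le> 1 / 2 * dist u v" using a(2) by (intro mult_right_mono) auto
      finally show "dist (apply_bcontfun (P u) t) (apply_bcontfun (P v) t) \<le> 1 / 2 * dist u v"
        by (simp add: P dist_norm I0)
    qed
  qed auto
  then obtain u where u: "P u = u" by blast
  have uc: "continuous_on UNIV (\<lambda>s. X (apply_bcontfun u s))"
    using apply_bcontfun[of u] by (intro continuous_on_compose2[OF Xc]) (auto simp: bcontfun_def)
  have ueq: "apply_bcontfun u t = z + I (\<lambda>s. X (apply_bcontfun u s)) t" if "\<bar>t\<bar> \<le> a" for t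
  proof -
    have "c t = t" using that by (auto simp: c_def)
    then show ?thesis using fun_cong[OF P[of u], of t] u by simp
  qed
  show ?thesis
  proof (rule that[of "apply_bcontfun u"])
    show "apply_bcontfun u 0 = z" using ueq[of 0] a by (simp add: I0)
    fix t assume t: "\<bar>t\<bar> \<le> a"
    have "((\<lambda>t. z + I (\<lambda>s. X (apply_bcontfun u s)) t) has_vector_derivative 0 + X (apply_bcontfun u t))
        (at t within {-a..a})"
      by (intro has_vector_derivative_add has_vector_derivative_const ID uc t)
    then have "((\<lambda>t. z + I (\<lambda>s. X (apply_bcontfun u s)) t) has_vector_derivative X (apply_bcontfun u t))
        (at t within {-a..a})" by simp
    then show "(apply_bcontfun u has_vector_derivative X (apply_bcontfun u t)) (at t within {-a..a})"
    proof (rule has_vector_derivative_transform[rotated 2])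
      show "t \<in> {-a..a}" using t by (simp add: abs_le_iff)
      show "apply_bcontfun u s = z + I (\<lambda>s. X (apply_bcontfun u s)) s" if "s \<in> {-a..a}" for s
        using that by (intro ueq) (simp add: abs_le_iff)
    qed
  qed
qed

text \<open>Speed is at most \<open>B\<close>, and initial distances grow at most by the factor 2
  within time \<open>a\<close>; so the flow is jointly Lipschitz. At time 0 it deviates from
  \<open>w + s *\<^sub>R X x\<close> only quadratically, which gives the joint derivative
  there.\<close>

lemma lipschitz_flow:
  fixes X :: "'e::euclidean_space \<Rightarrow> 'e"
  assumes lip: "L-lipschitz_on UNIV X" and bd: "\<And>x. norm (X x) \<le> B" and a: "a > 0" "a * L \<le> 1 / 2"
  obtains u where "\<And>z. u 0 z = z"
    "\<And>t z. \<bar>t\<bar> \<le> a \<Longrightarrow> ((\<lambda>t. u t z) has_vector_derivative X (u t z)) (at t within {-a..a})"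
    "\<And>t z. \<bar>t\<bar> \<le> a \<Longrightarrow> norm (u t z - z) \<le> B * \<bar>t\<bar>"
    "continuous_on ({-a..a} \<times> UNIV) (\<lambda>(t, z). u t z)"
    "\<And>x. ((\<lambda>(t, z). u t z) has_derivative (\<lambda>(s, w). w + s *\<^sub>R X x)) (at (0, x))"
proof -
  have "\<forall>z. \<exists>u. u 0 = z \<and>
      (\<forall>t. \<bar>t\<bar> \<le> a \<longrightarrow> (u has_vector_derivative X (u t)) (at t within {-a..a}))"
    using lipschitz_ode_solution[OF assms] by metis
  then obtain w where w: "\<And>z. w z 0 = z"
    "\<And>z t. \<bar>t\<bar> \<le> a \<Longrightarrow> (w z has_vector_derivative X (w z t)) (at t within {-a..a})"
    by metis
  define u where "u t z = w z t" for t z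
  have u0: "u 0 z = z" for z by (simp add: u_def w)
  have uD: "((\<lambda>t. u t z) has_vector_derivative X (u t z)) (at t within {-a..a})" if "\<bar>t\<bar> \<le> a" for t z
    unfolding u_def by (rule w(2)[OF that])
  have B0: "B \<ge> 0" using order_trans[OF norm_ge_zero bd[of 0]] .
  have L0: "L \<ge> 0" by (rule lipschitz_on_nonneg[OF lip])
  have ut: "norm (u t z - u s z) \<le> B * \<bar>t - s\<bar>" if "\<bar>s\<bar> \<le> a" "\<bar>t\<bar> \<le> a" for s t z
    by (rule has_vector_derivative_bound[OF uD bd that])
  have uz: "norm (u t z - u t z') \<le> 2 * norm (z - z')" if t: "\<bar>t\<bar> \<le> a" for t z z'
  proof -
    let ?d = "\<lambda>t. u t z - u t z'"
    have D: "(?d has_vector_derivative X (u s z) - X (u s z')) (at s within {-a..a})" if "\<bar>s\<bar> \<le> a" for s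
      by (intro has_vector_derivative_diff uD that)
    \<comment> \<open>In place of a Gronwall estimate: let m be the largest distance of the two
      solutions, attained at \<open>r\<close>. Then m \<le> |z - z'| + a L m \<le> |z - z'| + m/2,
      hence m \<le> 2 |z - z'|.\<close>
    have "continuous_on {-a..a} (\<lambda>s. norm (?d s))"
      by (intro continuous_on_norm has_vector_derivative_imp_continuous_on[OF D])
    then obtain r where r: "r \<in> {-a..a}" "\<And>s. s \<in> {-a..a} \<Longrightarrow> norm (?d s) \<le> norm (?d r)"
      using continuous_attains_sup[of "{-a..a}" "\<lambda>s. norm (?d s)"] a by auto
    have "norm (?d r - ?d 0) \<le> (L * norm (?d r)) * \<bar>r - 0\<bar>"
    proof (rule has_vector_derivative_bound[OF D])
      fix s assume s: "\<bar>s\<bar> \<le> a"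
      show "norm (X (u s z) - X (u s z')) \<le> L * norm (?d r)"
      proof -
        have "norm (X (u s z) - X (u s z')) \<le> L * norm (?d s)"
          using lipschitz_onD[OF lip, of "u s z" "u s z'"] by (simp add: dist_norm)
        also have "\<dots> \<le> L * norm (?d r)"
          using s by (intro mult_left_mono[OF r(2) L0]) auto
        finally show ?thesis .
      qed
    qed (use r a in auto)
    also have "\<dots> \<le> (L * norm (?d r)) * a"
      using r L0 by (intro mult_left_mono) auto
    also have "\<dots> = (a * L) * norm (?d r)" by simp
    also have "\<dots> \<le> 1 / 2 * norm (?d r)" using a(2) by (intro mult_right_mono) auto
    finally have "norm (?d r) \<le> norm (z - z') + 1 / 2 * norm (?d r)"
      using norm_triangle_sub[of "?d r" "?d 0"] by (simp add: u0)
    moreover have "norm (?d t) \<le> norm (?d r)" using t by (intro r(2)) auto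
    ultimately show ?thesis by simp
  qed
  have "(2 + B)-lipschitz_on ({-a..a} \<times> UNIV) (\<lambda>(t, z). u t z)"
  proof (rule lipschitz_onI)
    fix p q :: "real \<times> 'e" assume pq: "p \<in> {-a..a} \<times> UNIV" "q \<in> {-a..a} \<times> UNIV"
    obtain t z s y where [simp]: "p = (t, z)" "q = (s, y)" by (metis surj_pair)
    have "norm (u t z - u s y) \<le> norm (u t z - u t y) + norm (u t y - u s y)"
      using norm_triangle_ineq[of "u t z - u t y" "u t y - u s y"] by simp
    also have "\<dots> \<le> 2 * norm (z - y) + B * \<bar>t - s\<bar>"
      using pq by (intro add_mono uz ut) auto
    also have "\<dots> \<le> 2 * dist p q + B * dist p q"
      using dist_fst_le[of p q] dist_snd_le[of p q] B0
      by (intro add_mono mult_left_mono) (simp_all add: dist_norm)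
    finally show "dist (case p of (t, z) \<Rightarrow> u t z) (case q of (t, z) \<Rightarrow> u t z) \<le> (2 + B) * dist p q"
      by (simp add: dist_norm algebra_simps)
  qed (use B0 in auto)
  then have cont: "continuous_on ({-a..a} \<times> UNIV) (\<lambda>(t, z). u t z)"
    by (rule lipschitz_on_continuous_on)
  have "((\<lambda>(t, z). u t z) has_derivative (\<lambda>(s, w). w + s *\<^sub>R X x)) (at (0, x))" for x
  proof (rule has_derivative_at_quadratic[OF _ a(1)])
    show "bounded_linear (\<lambda>(s, w). w + s *\<^sub>R X x)"
      unfolding case_prod_unfold
      by (rule bounded_linear_add[OF bounded_linear_snd
            bounded_linear_compose[OF bounded_linear_scaleR_left bounded_linear_fst]])
    fix h :: "real \<times> 'e" assume h: "norm h < a"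
    obtain t w where [simp]: "h = (t, w)" by (metis surj_pair)
    have tw: "\<bar>t\<bar> \<le> norm h" "norm w \<le> norm h"
      using norm_fst_le[of t w] norm_snd_le[of w t] by auto
    let ?z = "x + w"
    \<comment> \<open>The curve from \<open>x + w\<close> is compared with the straight motion of
      velocity \<open>X x\<close>. Up to time \<open>t\<close> it stays within
      \<open>B * \<bar>t\<bar> + norm w\<close> of \<open>x\<close>, so the velocities differ by at
      most \<open>L\<close> times that.\<close>
    have "norm ((u t ?z - t *\<^sub>R X x) - (u 0 ?z - 0 *\<^sub>R X x)) \<le> (L * (B * \<bar>t\<bar> + norm w)) * \<bar>t - 0\<bar>"
    proof (rule has_vector_derivative_bound[where a = "\<bar>t\<bar>" and f = "\<lambda>s. u s ?z - s *\<^sub>R X x"])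
      fix s assume s: "\<bar>s\<bar> \<le> \<bar>t\<bar>"
      have sa: "\<bar>s\<bar> \<le> a" using s tw h by simp
      have "((\<lambda>s. u s ?z) has_vector_derivative X (u s ?z)) (at s within {-\<bar>t\<bar>..\<bar>t\<bar>})"
        by (rule has_vector_derivative_within_subset[OF uD[OF sa]]) (use tw h in auto)
      moreover have "((\<lambda>s. s *\<^sub>R X x) has_vector_derivative X x) (at s within {-\<bar>t\<bar>..\<bar>t\<bar>})"
        by (simp add: has_vector_derivative_def bounded_linear_imp_has_derivative bounded_linear_scaleR_left)
      ultimately show "((\<lambda>s. u s ?z - s *\<^sub>R X x) has_vector_derivative X (u s ?z) - X x)
          (at s within {-\<bar>t\<bar>..\<bar>t\<bar>})" by (rule has_vector_derivative_diff)
      have "norm (u s ?z - x) \<le> norm (u s ?z - u 0 ?z) + norm w"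
        using norm_triangle_ineq[of "u s ?z - u 0 ?z" w] by (simp add: u0)
      also have "\<dots> \<le> B * \<bar>t\<bar> + norm w"
        using ut[of 0 s ?z] mult_left_mono[OF s B0] sa a(1) by simp
      finally have "L * norm (u s ?z - x) \<le> L * (B * \<bar>t\<bar> + norm w)"
        using L0 by (rule mult_left_mono)
      then show "norm (X (u s ?z) - X x) \<le> L * (B * \<bar>t\<bar> + norm w)"
        using lipschitz_onD[OF lip, of "u s ?z" x] by (simp add: dist_norm)
    qed auto
    also have "\<dots> \<le> (L * (B * norm h + norm h)) * norm h"
    proof (rule mult_mono)
      show "L * (B * \<bar>t\<bar> + norm w) \<le> L * (B * norm h + norm h)"
        by (intro mult_left_mono add_mono tw B0 L0)
    qed (use tw L0 B0 in auto)
    finally show "norm ((case (0, x) + h of (t, z) \<Rightarrow> u t z) - (case (0, x) of (t, z) \<Rightarrow> u t z)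
        - (case h of (s, w) \<Rightarrow> w + s *\<^sub>R X x)) \<le> (L * (B + 1)) * (norm h)\<^sup>2"
      by (simp add: u0 power2_eq_square algebra_simps)
  qed
  moreover have "norm (u t z - z) \<le> B * \<bar>t\<bar>" if "\<bar>t\<bar> \<le> a" for t z
    using ut[of 0 t z] that a(1) by (simp add: u0)
  ultimately show ?thesis
    by (intro that[of u] u0 uD cont)
qed

section \<open>Poisson brackets in charts\<close>

lemma chartD:
  assumes "chart U \<phi>"
  shows "open U" "open (\<phi> ` U)" "continuous_on U \<phi>" "continuous_on (\<phi> ` U) (inv_into U \<phi>)" "inj_on \<phi> U"
    "\<And>y. y \<in> U \<Longrightarrow> inv_into U \<phi> (\<phi> y) = y"
proof -
  have h: "open U" "open (\<phi> ` U)" "homeomorphism U (\<phi> ` U) \<phi> (inv_into U \<phi>)"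
    using assms unfolding chart_def by blast+
  then show "open U" "open (\<phi> ` U)" by blast+
  show "continuous_on U \<phi>" "continuous_on (\<phi> ` U) (inv_into U \<phi>)"
    using h(3) unfolding homeomorphism_def by blast+
  show i: "inv_into U \<phi> (\<phi> y) = y" if "y \<in> U" for y
    using h(3) that unfolding homeomorphism_def by blast+
  show "inj_on \<phi> U" using i by (rule inj_on_inverseI)
qed

lemma chart_open_image:
  assumes "chart U \<phi>" "open W" "W \<subseteq> U"
  shows "open (\<phi> ` W)"
proof -
  have h: "homeomorphism U (\<phi> ` U) \<phi> (inv_into U \<phi>)" "open (\<phi> ` U)"
    using assms(1) by (auto simp: chart_def)
  have "openin (top_of_set U) W" using assms(2,3) by (auto simp: openin_open)
  from homeomorphism_imp_open_map[OF h(1) this] show ?thesis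
    using h(2) by (rule openin_open_trans)
qed

lemma smooth_onD: "smooth_on S f \<Longrightarrow> Ck_on k S f"
  by (simp add: smooth_on_def)

text \<open>The factor \<open>flat 0 (...)\<close> is the bump exp(-1/(r^2 - |\<phi> y - x0|^2)),
  positive inside radius \<open>r\<close> and zero elsewhere. It turns a function \<open>h\<close>
  of the coordinates into a function on the whole manifold.\<close>

definition bump_extension ::
  "'a set \<Rightarrow> ('a \<Rightarrow> 'e::real_inner) \<Rightarrow> 'e \<Rightarrow> real \<Rightarrow> ('e \<Rightarrow> real) \<Rightarrow> 'a \<Rightarrow> real" where
  "bump_extension U \<phi> x0 r h y =
    (if y \<in> U then flat 0 (r\<^sup>2 - (\<phi> y - x0) \<bullet> (\<phi> y - x0)) * h (\<phi> y) else 0)"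

lemma Ck_on_bump:
  assumes "open S" shows "Ck_on k S (\<lambda>x::'e::euclidean_space. flat 0 (r\<^sup>2 - (x - x0) \<bullet> (x - x0)))"
proof -
  have "Ck_on k S (\<lambda>x. r\<^sup>2 - (x - x0) \<bullet> (x - x0))"
  proof (cases k)
    case 0
    then show ?thesis by (auto intro!: continuous_intros)
  next
    case (Suc j)
    have "Ck_on j S (\<lambda>x. (2 *\<^sub>R v \<bullet> x0) + (-2 *\<^sub>R v) \<bullet> x)" for v :: 'e
      by (intro Ck_on_add Ck_on_const Ck_on_bounded_linear bounded_linear_inner_right assms)
    then show ?thesis
      unfolding Suc
      by (intro Ck_on_SucI[where f' = "\<lambda>x v. (2 *\<^sub>R v \<bullet> x0) + (-2 *\<^sub>R v) \<bullet> x"] assms)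
        (auto intro!: derivative_eq_intros simp: algebra_simps inner_commute)
  qed
  then show ?thesis by (intro Ck_on_compose[OF assms _ Ck_on_flat]) auto
qed

context
  fixes \<A> :: "('a::{t2_space,second_countable_topology}, 'e::euclidean_space) atlas"
  assumes atlas: "smooth_atlas \<A>"
begin

lemma atlas_chart: "(U, \<phi>) \<in> \<A> \<Longrightarrow> chart U \<phi>"
  using atlas by (auto simp: smooth_atlas_def)

section \<open>The algebra of smooth functions on the manifold, including bumps\<close>

lemma smooth_fun_Ck_on:
  "smooth_fun \<A> f \<Longrightarrow> (U, \<phi>) \<in> \<A> \<Longrightarrow> Ck_on k (\<phi> ` U) (\<lambda>x. f (inv_into U \<phi> x))"
  by (auto simp: smooth_fun_def smooth_on_def o_def)

lemma smooth_funI: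
  "(\<And>U \<phi> k. (U, \<phi>) \<in> \<A> \<Longrightarrow> open (\<phi> ` U) \<Longrightarrow> Ck_on k (\<phi> ` U) (\<lambda>x. f (inv_into U \<phi> x))) \<Longrightarrow> smooth_fun \<A> f"
  using chartD(2)[OF atlas_chart] by (auto simp: smooth_fun_def smooth_on_def o_def)

lemma smooth_fun_const: "smooth_fun \<A> (\<lambda>y. c)"
  by (rule smooth_funI) (rule Ck_on_const)

lemma smooth_fun_add: "smooth_fun \<A> f \<Longrightarrow> smooth_fun \<A> g \<Longrightarrow> smooth_fun \<A> (\<lambda>y. f y + g y)"
  by (rule smooth_funI) (intro Ck_on_add smooth_fun_Ck_on)

lemma smooth_fun_mult: "smooth_fun \<A> f \<Longrightarrow> smooth_fun \<A> g \<Longrightarrow> smooth_fun \<A> (\<lambda>y. f y * g y)"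
  by (rule smooth_funI) (intro Ck_on_mult smooth_fun_Ck_on)

lemma smooth_fun_sum:
  "(\<And>i. i \<in> I \<Longrightarrow> smooth_fun \<A> (f i)) \<Longrightarrow> smooth_fun \<A> (\<lambda>y. \<Sum>i\<in>I. f i y)"
  by (rule smooth_funI) (intro Ck_on_sum smooth_fun_Ck_on)

text \<open>In another chart two open sets cover the image: \<open>W1\<close>, where the transition
  map lands in the ball on which \<open>h\<close> is smooth, and \<open>W2\<close>, the part off the
  compact support \<open>K\<close>, where the function vanishes. \<open>W2\<close> is open because
  compact sets are closed in a Hausdorff space.\<close>

lemma smooth_fun_bump_extension:
  assumes U: "(U, \<phi>) \<in> \<A>" and R: "ball x0 R \<subseteq> \<phi> ` U" "0 < r" "r < R"
    and h: "smooth_on (ball x0 R) h"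
  shows "smooth_fun \<A> (bump_extension U \<phi> x0 r h)"
proof (rule smooth_funI)
  fix V \<psi> k assume V: "(V, \<psi>) \<in> \<A>"
  let ?q = "\<lambda>z. \<phi> (inv_into V \<psi> z)"
  let ?F = "\<lambda>z. bump_extension U \<phi> x0 r h (inv_into V \<psi> z)"
  define K where "K = inv_into U \<phi> ` cball x0 r"
  define W1 where "W1 = \<psi> ` (U \<inter> V) \<inter> ?q -` ball x0 R"
  define W2 where "W2 = \<psi> ` (V - K)"
  note cU = chartD[OF atlas_chart[OF U]] and cV = chartD[OF atlas_chart[OF V]]
  have rR: "cball x0 r \<subseteq> ball x0 R" using R by auto
  have "compact K"
    unfolding K_def using rR R by (intro compact_continuous_image continuous_on_subset[OF cU(4)]) auto
  then have "closed K" by (rule compact_imp_closed)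
  then have W2: "open W2"
    unfolding W2_def by (intro chart_open_image[OF atlas_chart[OF V]] open_Diff cV) auto
  have q: "Ck_on j (\<psi> ` (U \<inter> V)) ?q" for j
    using atlas U V by (fastforce simp: smooth_atlas_def compatible_def smooth_on_def o_def)
  have UV: "open (\<psi> ` (U \<inter> V))"
    by (intro chart_open_image[OF atlas_chart[OF V]] open_Int cU cV) auto
  have W1: "open W1"
    unfolding W1_def by (rule continuous_open_preimage[OF Ck_on_continuous_on[OF q] UV]) simp
  have "Ck_on k W1 (\<lambda>z. flat 0 (r\<^sup>2 - (?q z - x0) \<bullet> (?q z - x0)) * h (?q z))"
  proof (rule Ck_on_compose[OF W1, of ?q "ball x0 R" k "\<lambda>x. flat 0 (r\<^sup>2 - (x - x0) \<bullet> (x - x0)) * h x"])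
    show "Ck_on k (ball x0 R) (\<lambda>x. flat 0 (r\<^sup>2 - (x - x0) \<bullet> (x - x0)) * h x)"
      by (intro Ck_on_mult Ck_on_bump smooth_onD[OF h]) auto
    show "Ck_on k W1 ?q" by (rule Ck_on_subset[OF q]) (auto simp: W1_def)
  qed (auto simp: W1_def)
  then have 1: "Ck_on k W1 ?F"
    by (rule Ck_on_cong[OF W1, rotated]) (auto simp: W1_def bump_extension_def cV(6))
  have 2: "Ck_on k W2 ?F"
  proof (rule Ck_on_cong[OF W2 _ Ck_on_const[OF W2]])
    fix z assume "z \<in> W2"
    then obtain y where y: "y \<in> V" "y \<notin> K" "z = \<psi> y" by (auto simp: W2_def)
    have "flat 0 (r\<^sup>2 - (\<phi> y - x0) \<bullet> (\<phi> y - x0)) = 0" if "y \<in> U"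
    proof -
      have "\<phi> y \<notin> cball x0 r" using y(2) cU(6)[OF that] unfolding K_def by (metis imageI)
      then have "r\<^sup>2 < (norm (\<phi> y - x0))\<^sup>2"
        using R(2) by (intro power_strict_mono) (auto simp: dist_norm norm_minus_commute)
      then show ?thesis by (simp add: flat_def dot_square_norm)
    qed
    then show "0 = ?F z" using y by (simp add: bump_extension_def cV(6))
  qed
  have "\<psi> ` V \<subseteq> W1 \<union> W2"
  proof
    fix z assume "z \<in> \<psi> ` V"
    then obtain y where y: "y \<in> V" "z = \<psi> y" by auto
    show "z \<in> W1 \<union> W2"
    proof (cases "y \<in> K")
      case True
      then obtain x where x: "x \<in> cball x0 r" "y = inv_into U \<phi> x" by (auto simp: K_def)
      have "x \<in> \<phi> ` U" using x rR R by blast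
      then have "y \<in> U" "\<phi> y = x" using x by (auto simp: inv_into_into f_inv_into_f)
      then show ?thesis using x rR y by (auto simp: W1_def cV(6))
    next
      case False
      then show ?thesis using y by (auto simp: W2_def)
    qed
  qed
  then show "Ck_on k (\<psi> ` V) ?F"
    by (rule Ck_on_subset[OF Ck_on_Un[OF W1 W2 1 2]])
qed

context
  fixes pb :: "'a bracket"
  assumes pb: "poisson_bracket \<A> pb"
begin

section \<open>The bracket as a derivation of its second argument\<close>

lemma bracket_smooth: "smooth_fun \<A> f \<Longrightarrow> smooth_fun \<A> g \<Longrightarrow> smooth_fun \<A> (pb f g)"
  using pb unfolding poisson_bracket_def by blast

lemma bracket_mult:
  assumes "smooth_fun \<A> H" "smooth_fun \<A> f" "smooth_fun \<A> g"
  shows "pb H (\<lambda>y. f y * g y) y = pb H f y * g y + f y * pb H g y"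
proof -
  have "pb H (\<lambda>y. f y * g y) = (\<lambda>y. pb H f y * g y + f y * pb H g y)"
    using pb assms unfolding poisson_bracket_def by blast
  then show ?thesis by (rule fun_cong)
qed

lemma bracket_linear:
  assumes "smooth_fun \<A> H" "smooth_fun \<A> f" "smooth_fun \<A> g"
  shows "pb H (\<lambda>y. a * f y + b * g y) y = a * pb H f y + b * pb H g y"
proof -
  have anti: "pb f g = (\<lambda>y. - pb g f y)" if "smooth_fun \<A> f" "smooth_fun \<A> g" for f g
    using pb that unfolding poisson_bracket_def by blast
  have "smooth_fun \<A> (\<lambda>y. a * f y + b * g y)"
    using assms by (intro smooth_fun_add smooth_fun_mult smooth_fun_const)
  then have "pb H (\<lambda>y. a * f y + b * g y) y = - pb (\<lambda>y. a * f y + b * g y) H y"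
    by (rule fun_cong[OF anti[OF assms(1)]])
  also have "pb (\<lambda>y. a * f y + b * g y) H = (\<lambda>y. a * pb f H y + b * pb g H y)"
    using pb assms unfolding poisson_bracket_def by blast
  finally show ?thesis using fun_cong[OF anti[OF assms(1,2)], of y] fun_cong[OF anti[OF assms(1,3)], of y] by simp
qed

lemma bracket_sum:
  assumes "smooth_fun \<A> H" "finite I" "\<And>i. i \<in> I \<Longrightarrow> smooth_fun \<A> (f i)"
  shows "pb H (\<lambda>y. \<Sum>i\<in>I. f i y) y = (\<Sum>i\<in>I. pb H (f i) y)"
  using assms(2,3)
proof (induction I rule: finite_induct)
  case empty
  show ?case
    using bracket_linear[OF assms(1) smooth_fun_const smooth_fun_const, of 0 0 0 0 y] by simp
next
  case (insert i I)
  then show ?case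
    using bracket_linear[OF assms(1), of "f i" "\<lambda>y. \<Sum>i\<in>I. f i y" 1 1 y] smooth_fun_sum[of I f] by simp
qed

text \<open>A derivation is evaluated on the Hadamard expansion multiplied by the square of a bump \<open>\<beta>\<close>
  that is only required to be positive. The terms containing the bracket with \<open>\<beta>\<^sup>2\<close> cancel, so that
  neither a plateau of \<open>\<beta>\<close> nor the locality of the bracket is needed.\<close>

lemma bracket_in_chart:
  assumes H: "smooth_fun \<A> H" and U: "(U, \<phi>) \<in> \<A>" and R: "ball x0 R \<subseteq> \<phi> ` U" "0 < r" "r < R"
  obtains X where "smooth_on (ball x0 r) X"
    "\<And>f x. smooth_fun \<A> f \<Longrightarrow> x \<in> ball x0 r \<Longrightarrow>
      pb H f (inv_into U \<phi> x) = frechet_derivative (\<lambda>x. f (inv_into U \<phi> x)) (at x) (X x)"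
proof -
  let ?i = "inv_into U \<phi>" and ?E = "bump_extension U \<phi> x0 r"
  define \<beta> where "\<beta> x = flat 0 (r\<^sup>2 - (x - x0) \<bullet> (x - x0))" for x
  \<comment> \<open>The components are ({H, \<beta> x_b} - x_b {H, \<beta>}) / \<beta>. By the
    Leibniz rule this is what {H, x_b} should be, written with globally defined functions
    only.\<close>
  define X where "X x = (\<Sum>b\<in>Basis. ((pb H (?E (\<lambda>x. b \<bullet> x)) (?i x) + (- 1 * (b \<bullet> x)) * pb H (?E (\<lambda>x. 1)) (?i x))
      * inverse (\<beta> x)) *\<^sub>R b)" for x
  note cU = chartD[OF atlas_chart[OF U]]
  have rR: "ball x0 r \<subseteq> ball x0 R" using R by auto
  have b_pos: "\<beta> x > 0" if "x \<in> ball x0 r" for x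
  proof -
    have "(norm (x - x0))\<^sup>2 < r\<^sup>2"
      using that R(2) by (intro power_strict_mono) (auto simp: dist_norm norm_minus_commute)
    then show ?thesis by (simp add: \<beta>_def flat_def dot_square_norm)
  qed
  have b_zero: "\<beta> x = 0" if "x \<notin> ball x0 R" for x
  proof -
    have "r\<^sup>2 \<le> (norm (x - x0))\<^sup>2"
      using that R by (intro power_mono) (auto simp: dist_norm norm_minus_commute)
    then show ?thesis by (simp add: \<beta>_def flat_def dot_square_norm)
  qed
  have E: "smooth_fun \<A> (?E h)" if "smooth_on (ball x0 R) h" for h
    by (rule smooth_fun_bump_extension[OF U R that])
  have E1: "smooth_fun \<A> (?E (\<lambda>x. 1))"
    by (rule E) (simp add: smooth_on_def Ck_on_const)
  have Eb: "smooth_fun \<A> (?E (\<lambda>x. b \<bullet> x))" for b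
    by (rule E) (simp add: smooth_on_def Ck_on_bounded_linear bounded_linear_inner_right)
  have Ey: "?E h y = (if y \<in> U then \<beta> (\<phi> y) * h (\<phi> y) else 0)" for h y
    by (simp add: bump_extension_def \<beta>_def)
  have "Ck_on k (ball x0 r) X" for k
    unfolding X_def
  proof (rule Ck_on_sum)
    fix b :: 'e
    have rU: "ball x0 r \<subseteq> \<phi> ` U" using rR R by blast
    have "Ck_on k (ball x0 r) (\<lambda>x. pb H (?E (\<lambda>x. b \<bullet> x)) (?i x))"
      "Ck_on k (ball x0 r) (\<lambda>x. pb H (?E (\<lambda>x. 1)) (?i x))"
      by (intro Ck_on_subset[OF smooth_fun_Ck_on[OF _ U] rU] bracket_smooth H Eb E1)+
    moreover have "Ck_on k (ball x0 r) (\<lambda>x. inverse (\<beta> x))"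
    proof (rule Ck_on_inverse)
      show "Ck_on k (ball x0 r) \<beta>" unfolding \<beta>_def by (rule Ck_on_bump) simp
      show "\<beta> x \<noteq> 0" if "x \<in> ball x0 r" for x using b_pos[OF that] by simp
    qed simp
    moreover have "Ck_on k (ball x0 r) (\<lambda>x. - 1 * (b \<bullet> x))"
      by (intro Ck_on_mult Ck_on_const Ck_on_bounded_linear bounded_linear_inner_right) simp_all
    ultimately show "Ck_on k (ball x0 r) (\<lambda>x. ((pb H (?E (\<lambda>x. b \<bullet> x)) (?i x) +
        (- 1 * (b \<bullet> x)) * pb H (?E (\<lambda>x. 1)) (?i x)) * inverse (\<beta> x)) *\<^sub>R b)"
      by (intro Ck_on_scaleR[OF _ _ Ck_on_const] Ck_on_mult[OF _ Ck_on_add[OF _ _ Ck_on_mult]]) simp_all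
  qed simp
  then have X: "smooth_on (ball x0 r) X" by (simp add: smooth_on_def)
  have "pb H f (?i x) = frechet_derivative (\<lambda>x. f (?i x)) (at x) (X x)"
    if f: "smooth_fun \<A> f" and x: "x \<in> ball x0 r" for f x
  proof -
    let ?D = "frechet_derivative (\<lambda>x. f (?i x)) (at x)"
    define y where "y = ?i x"
    have y: "y \<in> U" "\<phi> y = x"
      using x rR R unfolding y_def by (auto intro!: inv_into_into f_inv_into_f)
    have "smooth_on (ball x0 R) (\<lambda>x. f (?i x))"
      using smooth_fun_Ck_on[OF f U] R(1) by (auto simp: smooth_on_def intro: Ck_on_subset)
    from Hadamard[OF open_ball convex_ball subsetD[OF rR x] this]
    obtain h where h: "\<And>b. smooth_on (ball x0 R) (h b)"
      "\<And>x'. x' \<in> ball x0 R \<Longrightarrow> f (?i x') = f (?i x) + (\<Sum>b\<in>Basis. ((x' - x) \<bullet> b) * h b x')"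
      "\<And>b. h b x = ?D b"
      by metis
    let ?e = "?E (\<lambda>x. 1)" and ?x = "\<lambda>b. ?E (\<lambda>x. b \<bullet> x)"
    \<comment> \<open>The Hadamard expansion times \<beta>^2, with one \<beta> given to the
      coordinate difference and one to \<open>h b\<close>, so that every factor is globally smooth.
      Off the ball of radius \<open>R\<close> both sides vanish with \<beta>. The factors
      \<open>1 *\<close> fit the shape of \<open>bracket_linear\<close>.\<close>
    have id: "f y' * (?e y' * ?e y') =
        f y * (?e y' * ?e y') + 1 * (\<Sum>b\<in>Basis. (1 * ?x b y' + (- (b \<bullet> x)) * ?e y') * ?E (h b) y')" for y'
    proof (cases "y' \<in> U \<and> \<phi> y' \<in> ball x0 R")
      case True
      then have "f y' = f y + (\<Sum>b\<in>Basis. ((\<phi> y' - x) \<bullet> b) * h b (\<phi> y'))"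
        using h(2)[of "\<phi> y'"] cU(6)[of y'] by (simp add: y_def)
      then show ?thesis
        using True by (simp add: Ey distrib_right sum_distrib_left sum_distrib_right inner_diff_left
            inner_commute algebra_simps)
    next
      case False
      then show ?thesis using b_zero by (auto simp: Ey)
    qed
    have s: "smooth_fun \<A> (\<lambda>y'. 1 * ?x b y' + (- (b \<bullet> x)) * ?e y')" for b
      by (intro smooth_fun_add smooth_fun_mult smooth_fun_const Eb E1)
    have e2: "smooth_fun \<A> (\<lambda>y'. ?e y' * ?e y')" by (intro smooth_fun_mult E1)
    have sE: "smooth_fun \<A> (\<lambda>y'. (1 * ?x b y' + (- (b \<bullet> x)) * ?e y') * ?E (h b) y')" for b
      by (intro smooth_fun_mult s E h)
    have ev: "?e y = \<beta> x" "?x b y = \<beta> x * (b \<bullet> x)" "?E (h b) y = \<beta> x * ?D b" for b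
      using y by (simp_all add: Ey h(3))
    have "pb H f y * (\<beta> x * \<beta> x) + f y * pb H (\<lambda>y'. ?e y' * ?e y') y = pb H (\<lambda>y'. f y' * (?e y' * ?e y')) y"
      using bracket_mult[OF H f e2, of y] ev by simp
    also have "\<dots> = f y * pb H (\<lambda>y'. ?e y' * ?e y') y +
        1 * pb H (\<lambda>y'. \<Sum>b\<in>Basis. (1 * ?x b y' + (- (b \<bullet> x)) * ?e y') * ?E (h b) y') y"
      unfolding id by (rule bracket_linear[OF H e2 smooth_fun_sum[OF sE]])
    also have "pb H (\<lambda>y'. \<Sum>b\<in>Basis. (1 * ?x b y' + (- (b \<bullet> x)) * ?e y') * ?E (h b) y') y =
        (\<Sum>b\<in>Basis. pb H (\<lambda>y'. (1 * ?x b y' + (- (b \<bullet> x)) * ?e y') * ?E (h b) y') y)"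
      by (rule bracket_sum[OF H _ sE]) simp
    \<comment> \<open>The coordinate difference vanishes at \<open>y\<close>, so of the two Leibniz
      terms only the one that differentiates it survives.\<close>
    also have "\<dots> = (\<Sum>b\<in>Basis. (pb H (?x b) y + (- (b \<bullet> x)) * pb H ?e y) * (\<beta> x * ?D b))"
    proof (rule sum.cong[OF refl])
      fix b :: 'e
      show "pb H (\<lambda>y'. (1 * ?x b y' + (- (b \<bullet> x)) * ?e y') * ?E (h b) y') y =
          (pb H (?x b) y + (- (b \<bullet> x)) * pb H ?e y) * (\<beta> x * ?D b)"
        unfolding bracket_mult[OF H s E[OF h(1)]] bracket_linear[OF H Eb E1] ev by simp
    qed
    finally have "pb H f y * (\<beta> x * \<beta> x) = \<beta> x * (\<Sum>b\<in>Basis. (pb H (?x b) y + (- (b \<bullet> x)) * pb H ?e y) * ?D b)"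
      by (simp add: sum_distrib_left mult_ac)
    then have "pb H f y = inverse (\<beta> x) * (\<Sum>b\<in>Basis. (pb H (?x b) y + (- (b \<bullet> x)) * pb H ?e y) * ?D b)"
      using b_pos[OF x] by (simp add: field_simps)
    also have "\<dots> = ?D (X x)"
    proof -
      have "linear ?D"
        using Ck_on_Suc_has_derivative[OF smooth_fun_Ck_on[OF f U, of "Suc 0"]] x rR R
        by (intro has_derivative_linear) blast
      then show ?thesis
        by (simp add: X_def linear_sum linear_scale y_def sum_distrib_left mult_ac)
    qed
    finally show ?thesis by (simp add: y_def)
  qed
  with X show ?thesis by (rule that)
qed

end
end

section \<open>Local flows and their composition\<close>

text \<open>Compactness bounds each directional derivative on \<open>K\<close>, the sum over
  \<open>Basis\<close> bounds the operator norm, and convexity allows the mean value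
  inequality.\<close>

lemma Ck_on_lipschitz_on:
  fixes X :: "'e::euclidean_space \<Rightarrow> 'b::real_normed_vector"
  assumes "Ck_on (Suc 0) S X" "compact K" "convex K" "K \<subseteq> S"
  obtains L where "L-lipschitz_on K X"
proof -
  let ?D = "\<lambda>x. frechet_derivative X (at x)"
  have D: "(X has_derivative ?D x) (at x)" if "x \<in> K" for x
    using Ck_on_Suc_has_derivative[OF assms(1)] that assms(4) by blast
  have "\<exists>M. \<forall>x\<in>K. norm (?D x b) \<le> M" for b
  proof -
    have "continuous_on K (\<lambda>x. ?D x b)"
      using assms(1,4) by (auto intro: continuous_on_subset)
    then have "bounded ((\<lambda>x. ?D x b) ` K)"
      by (intro compact_imp_bounded compact_continuous_image assms(2))
    then show ?thesis by (auto simp: bounded_iff)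
  qed
  then obtain M where M: "\<And>b x. x \<in> K \<Longrightarrow> norm (?D x b) \<le> M b" by metis
  \<comment> \<open>Absolute values keep the constant nonnegative even for empty \<open>K\<close>,
    where \<open>M b\<close> is arbitrary.\<close>
  have "(\<Sum>b\<in>Basis. \<bar>M b\<bar>)-lipschitz_on K X"
  proof (rule lipschitz_onI)
    fix x y assume xy: "x \<in> K" "y \<in> K"
    have "norm (X x - X y) \<le> (\<Sum>b\<in>Basis. \<bar>M b\<bar>) * norm (x - y)"
    proof (rule differentiable_bound)
      fix z assume z: "z \<in> K"
      show "(X has_derivative ?D z) (at z within K)"
        using D[OF z] by (rule has_derivative_at_withinI)
      show "onorm (?D z) \<le> (\<Sum>b\<in>Basis. \<bar>M b\<bar>)"
      proof (rule onorm_le)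
        fix v
        have lin: "linear (?D z)" using D[OF z] by (rule has_derivative_linear)
        have "?D z v = ?D z (\<Sum>b\<in>Basis. (v \<bullet> b) *\<^sub>R b)" by (simp add: euclidean_representation)
        also have "\<dots> = (\<Sum>b\<in>Basis. (v \<bullet> b) *\<^sub>R ?D z b)"
          by (simp only: linear_sum[OF lin] linear_scale[OF lin])
        also have "norm \<dots> \<le> (\<Sum>b\<in>Basis. norm v * \<bar>M b\<bar>)"
        proof (rule sum_norm_le)
          fix b :: 'e assume "b \<in> Basis"
          then have "\<bar>v \<bullet> b\<bar> \<le> norm v" by (rule Basis_le_norm)
          moreover have "norm (?D z b) \<le> \<bar>M b\<bar>" using M[OF z, of b] by simp
          ultimately show "norm ((v \<bullet> b) *\<^sub>R ?D z b) \<le> norm v * \<bar>M b\<bar>"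
            by (simp add: mult_mono)
        qed
        finally show "norm (?D z v) \<le> (\<Sum>b\<in>Basis. \<bar>M b\<bar>) * norm v"
          by (simp add: sum_distrib_left mult.commute)
      qed
    qed (use assms(3) xy in auto)
    then show "dist (X x) (X y) \<le> (\<Sum>b\<in>Basis. \<bar>M b\<bar>) * dist x y"
      by (simp add: dist_norm)
  qed (simp add: sum_nonneg)
  then show ?thesis by (rule that)
qed

text \<open>The radii: the field \<open>X\<close> lives on radius \<open>R / 2\<close> and is
  Lipschitz on the closed ball of radius \<open>R / 4\<close>. A curve from radius
  \<open>R / 8\<close> travels at most \<open>B * a \<le> R / 8\<close>, so it never leaves that
  ball and is an integral curve of \<open>X\<close> itself.\<close>

lemma bracket_local_flow:
  fixes \<A> :: "('a::{t2_space,second_countable_topology}, 'e::euclidean_space) atlas"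
  assumes A: "smooth_atlas \<A>" and pb: "poisson_bracket \<A> pb" and H: "smooth_fun \<A> H"
    and U: "(U, \<phi>) \<in> \<A>" and R: "ball x0 R \<subseteq> \<phi> ` U" "R > 0"
  obtains a u v where "a > 0" "continuous_on ({-a..a} \<times> UNIV) (\<lambda>(t, z). u t z)" "u 0 x0 = x0"
    "((\<lambda>(t, z). u t z) has_derivative (\<lambda>(s, w). w + s *\<^sub>R v)) (at (0, x0))"
    "\<And>f. smooth_fun \<A> f \<Longrightarrow>
      pb H f (inv_into U \<phi> x0) = frechet_derivative (\<lambda>x. f (inv_into U \<phi> x)) (at x0) v"
    "\<And>t z. \<bar>t\<bar> \<le> a \<Longrightarrow> z \<in> ball x0 (R / 8) \<Longrightarrow>
      flow_to \<A> pb H t (inv_into U \<phi> z) (inv_into U \<phi> (u t z))"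
proof -
  let ?i = "inv_into U \<phi>" and ?K = "cball x0 (R / 4)"
  note cU = chartD[OF atlas_chart[OF A U]]
  obtain X where X: "smooth_on (ball x0 (R / 2)) X"
    "\<And>f x. smooth_fun \<A> f \<Longrightarrow> x \<in> ball x0 (R / 2) \<Longrightarrow>
      pb H f (?i x) = frechet_derivative (\<lambda>x. f (?i x)) (at x) (X x)"
    using bracket_in_chart[OF A pb H U R(1), of "R / 2"] R(2) by auto
  have K: "?K \<subseteq> ball x0 (R / 2)" "?K \<subseteq> \<phi> ` U" "?K \<noteq> {}" "convex ?K" "closed ?K" "compact ?K"
  proof -
    show "?K \<subseteq> ball x0 (R / 2)" using R(2) by auto
    moreover have "ball x0 (R / 2) \<subseteq> ball x0 R" using R(2) by auto
    ultimately show "?K \<subseteq> \<phi> ` U" using R(1) by blast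
  qed (use R(2) in auto)
  obtain L where L: "L-lipschitz_on ?K X"
    using Ck_on_lipschitz_on[OF smooth_onD[OF X(1)] K(6,4,1)] by blast
  note L0 = lipschitz_on_nonneg[OF L]
  have "bounded (X ` ?K)"
    by (intro compact_imp_bounded compact_continuous_image lipschitz_on_continuous_on[OF L] K)
  then obtain B where B: "B > 0" "\<And>x. x \<in> ?K \<Longrightarrow> norm (X x) \<le> B"
    by (auto simp: bounded_pos)
  \<comment> \<open>Nearest-point projection onto a closed convex set is 1-Lipschitz, so
    \<open>Y\<close> extends \<open>X\<close> to the whole space with the same bounds.\<close>
  define Y where "Y x = X (closest_point ?K x)" for x
  have cp: "closest_point ?K x \<in> ?K" for x by (rule closest_point_in_set[OF K(5,3)])
  have Y: "Y x = X x" if "x \<in> ?K" for x using that by (simp add: Y_def closest_point_self)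
  have YL: "L-lipschitz_on UNIV Y"
  proof (rule lipschitz_onI[OF _ L0])
    fix x y :: 'e
    have "dist (Y x) (Y y) \<le> L * dist (closest_point ?K x) (closest_point ?K y)"
      unfolding Y_def by (rule lipschitz_onD[OF L cp cp])
    also have "\<dots> \<le> L * dist x y"
      by (rule mult_left_mono[OF closest_point_lipschitz[OF K(4,5,3)] L0])
    finally show "dist (Y x) (Y y) \<le> L * dist x y" .
  qed
  have YB: "norm (Y x) \<le> B" for x unfolding Y_def by (rule B(2)[OF cp])
  \<comment> \<open>short enough for a contraction, and for the cut-off to have no effect along the flow\<close>
  define a where "a = min (1 / (2 * (L + 1))) (R / (8 * B))"
  have a: "a > 0" using L0 B(1) R(2) by (simp add: a_def)
  have aL: "a * L \<le> 1 / 2"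
  proof -
    have "a * L \<le> 1 / (2 * (L + 1)) * L" by (rule mult_right_mono[OF _ L0]) (simp add: a_def)
    also have "\<dots> \<le> 1 / 2" using L0 by (simp add: field_simps)
    finally show ?thesis .
  qed
  have aB: "B * a \<le> R / 8"
  proof -
    have "B * a \<le> B * (R / (8 * B))" using B(1) by (intro mult_left_mono) (auto simp: a_def)
    then show ?thesis using B(1) by simp
  qed
  obtain u where u: "\<And>z. u 0 z = z"
    "\<And>t z. \<bar>t\<bar> \<le> a \<Longrightarrow> ((\<lambda>t. u t z) has_vector_derivative Y (u t z)) (at t within {-a..a})"
    "\<And>t z. \<bar>t\<bar> \<le> a \<Longrightarrow> norm (u t z - z) \<le> B * \<bar>t\<bar>"
    "continuous_on ({-a..a} \<times> UNIV) (\<lambda>(t, z). u t z)"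
    "\<And>x. ((\<lambda>(t, z). u t z) has_derivative (\<lambda>(s, w). w + s *\<^sub>R Y x)) (at (0, x))"
    by (rule lipschitz_flow[OF YL YB a aL], rule that)
  have flow: "flow_to \<A> pb H t (?i z) (?i (u t z))" if t: "\<bar>t\<bar> \<le> a" and z: "z \<in> ball x0 (R / 8)" for t z
    unfolding flow_to_def integral_curve_def
  proof (intro exI[of _ "\<lambda>s. ?i (u s z)"] conjI allI impI ballI)
    let ?I = "closed_segment 0 t"
    have I: "?I \<subseteq> {-a..a}" using t by (auto simp: closed_segment_eq_real_ivl split: if_splits)
    have uK: "u s z \<in> ?K" if "s \<in> ?I" for s
    proof -
      have s: "\<bar>s\<bar> \<le> a" using subsetD[OF I that] by (simp add: abs_le_iff)
      have "norm (u s z - z) \<le> B * \<bar>s\<bar>" by (rule u(3)[OF s])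
      also have "\<dots> \<le> B * a" using s B(1) by (intro mult_left_mono) auto
      finally have "dist z (u s z) \<le> R / 8" using aB by (simp add: dist_norm norm_minus_commute)
      then show ?thesis using z dist_triangle[of x0 "u s z" z] by simp
    qed
    have uD: "((\<lambda>s. u s z) has_vector_derivative X (u s z)) (at s within ?I)" if s: "s \<in> ?I" for s
    proof -
      have "\<bar>s\<bar> \<le> a" using subsetD[OF I s] by (simp add: abs_le_iff)
      from has_vector_derivative_within_subset[OF u(2)[OF this] I, of z]
      show ?thesis by (simp add: Y[OF uK[OF s]])
    qed
    have "continuous_on ?I (\<lambda>s. u s z)"
      unfolding continuous_on_eq_continuous_within
      by (intro ballI has_vector_derivative_continuous[OF uD])
    then show "continuous_on ?I (\<lambda>s. ?i (u s z))"
      by (rule continuous_on_compose2[OF cU(4)]) (use uK K(2) in blast)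
    fix f s assume f: "smooth_fun \<A> f" and s: "s \<in> ?I"
    have "((\<lambda>x. f (?i x)) has_derivative frechet_derivative (\<lambda>x. f (?i x)) (at (u s z))) (at (u s z))"
      using Ck_on_Suc_has_derivative[OF smooth_fun_Ck_on[OF A f U]] uK[OF s] K(2) by blast
    from vector_derivative_diff_chain_within[OF uD[OF s] has_derivative_at_withinI[OF this]]
    have "((\<lambda>s. f (?i (u s z))) has_vector_derivative pb H f (?i (u s z))) (at s within ?I)"
      using X(2)[OF f] uK[OF s] K(1) by (auto simp: o_def subset_iff)
    then show "((f \<circ> (\<lambda>s. ?i (u s z))) has_real_derivative pb H f (?i (u s z))) (at s within ?I)"
      by (simp add: has_real_derivative_iff_has_vector_derivative o_def)
  qed (simp_all add: u(1))
  have x0: "x0 \<in> ?K" using R(2) by simp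
  show ?thesis
  proof (rule that[OF a u(4) u(1) u(5)[of x0]])
    show "pb H f (?i x0) = frechet_derivative (\<lambda>x. f (?i x)) (at x0) (Y x0)" if "smooth_fun \<A> f" for f
      using X(2)[OF that, of x0] R(2) by (simp add: Y[OF x0])
  qed (rule flow)
qed

text \<open>The last list entry acts first on \<open>x0\<close>; each flow reads its time from its
  own coordinate of \<open>t\<close>.\<close>

definition compose_flows :: "('n::finite \<Rightarrow> real \<Rightarrow> 'e \<Rightarrow> 'e) \<Rightarrow> 'e \<Rightarrow> 'n list \<Rightarrow> real ^ 'n \<Rightarrow> 'e" where
  "compose_flows u x0 ks t = foldr (\<lambda>k. u k (t $ k)) ks x0"

lemma compose_flows_simps:
  "compose_flows u x0 [] t = x0"
  "compose_flows u x0 (k # ks) t = u k (t $ k) (compose_flows u x0 ks t)"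
  by (simp_all add: compose_flows_def)

text \<open>At \<open>t = 0\<close> every flow of the chain is evaluated at \<open>(0, x0)\<close>.
  There its derivative passes the inner increment on unchanged and adds
  \<open>s *\<^sub>R v k\<close>, so the contributions simply add up along the list.\<close>

lemma compose_flows:
  fixes u :: "'n::finite \<Rightarrow> real \<Rightarrow> 'e::euclidean_space \<Rightarrow> 'e"
  assumes "\<And>k. continuous_on ({-a..a} \<times> UNIV) (\<lambda>(t, z). u k t z)" "\<And>k. u k 0 x0 = x0"
    "\<And>k. ((\<lambda>(t, z). u k t z) has_derivative (\<lambda>(s, w). w + s *\<^sub>R v k)) (at (0, x0))"
  shows compose_flows_zero: "compose_flows u x0 ks 0 = x0"
    and compose_flows_continuous: "continuous_on (ball 0 a) (compose_flows u x0 ks)"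
    and compose_flows_derivative:
      "(compose_flows u x0 ks has_derivative (\<lambda>t. \<Sum>k\<leftarrow>ks. t $ k *\<^sub>R v k)) (at 0)"
proof -
  show zero: "compose_flows u x0 ks 0 = x0" for ks
    by (induction ks) (simp_all add: compose_flows_simps assms(2))
  show "continuous_on (ball 0 a) (compose_flows u x0 ks)"
  proof (induction ks)
    case Nil
    then show ?case by (simp add: compose_flows_simps)
  next
    case (Cons k ks)
    have "continuous_on (ball 0 a) (\<lambda>t::real ^ 'n. t $ k)" by (intro continuous_intros)
    from continuous_on_compose2[OF assms(1) continuous_on_Pair[OF this Cons.IH], of k]
    show ?case
    proof (simp add: compose_flows_simps, elim meta_mp)
      show "(\<lambda>t. (t $ k, compose_flows u x0 ks t)) ` ball 0 a \<subseteq> {-a..a} \<times> UNIV"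
      proof
        fix p assume "p \<in> (\<lambda>t. (t $ k, compose_flows u x0 ks t)) ` ball 0 a"
        then obtain t where "norm t < a" "p = (t $ k, compose_flows u x0 ks t)" by auto
        then show "p \<in> {-a..a} \<times> UNIV" using component_le_norm_cart[of t k] by auto
      qed
    qed
  qed
  show "(compose_flows u x0 ks has_derivative (\<lambda>t. \<Sum>k\<leftarrow>ks. t $ k *\<^sub>R v k)) (at 0)"
  proof (induction ks)
    case Nil
    then show ?case by (simp add: compose_flows_simps)
  next
    case (Cons k ks)
    have "((\<lambda>t::real ^ 'n. t $ k) has_derivative (\<lambda>t. t $ k)) (at 0)"
      by (rule bounded_linear_imp_has_derivative) (rule bounded_linear_vec_nth)
    from has_derivative_Pair[OF this Cons.IH]
    have "((\<lambda>t. (t $ k, compose_flows u x0 ks t)) has_derivative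
        (\<lambda>t. (t $ k, \<Sum>k\<leftarrow>ks. t $ k *\<^sub>R v k))) (at 0)" .
    moreover have "((\<lambda>(t, z). u k t z) has_derivative (\<lambda>(s, w). w + s *\<^sub>R v k))
        (at (0 $ k, compose_flows u x0 ks 0))"
      using assms(3)[of k] by (simp add: zero)
    ultimately have "((\<lambda>t. (\<lambda>(t, z). u k t z) (t $ k, compose_flows u x0 ks t)) has_derivative
        (\<lambda>t. (\<lambda>(s, w). w + s *\<^sub>R v k) (t $ k, \<Sum>k\<leftarrow>ks. t $ k *\<^sub>R v k))) (at 0)"
      by (rule has_derivative_compose)
    then show ?case by (simp add: compose_flows_simps add.commute)
  qed
qed

text \<open>\<open>H\<close> need not be injective or differentiable away from \<open>0\<close>, so the inverse function theorem does
  not apply. Brouwer's theorem yields preimages, and the lower bound on \<open>H\<close> makes any choice of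
  them continuous at \<open>H 0\<close>.\<close>

lemma has_derivative_local_inverse:
  fixes H :: "'a::real_normed_vector \<Rightarrow> 'b::euclidean_space" and F :: "'b \<Rightarrow> 'c::real_normed_vector"
  assumes d: "\<delta> > 0" and cont: "continuous_on (ball 0 \<delta>) H" and H: "(H has_derivative H') (at 0)"
    and h: "(h has_derivative h') (at 0)" and G: "bounded_linear G'" "H' \<circ> G' = id" "G' \<circ> H' = id"
    and F: "\<And>t. t \<in> ball 0 \<delta> \<Longrightarrow> F (H t) = h t"
  shows "H 0 \<in> interior (H ` ball 0 \<delta>)" "(F has_derivative (\<lambda>v. h' (G' v))) (at (H 0))"
proof -
  \<comment> \<open>The right inverse of the derivative makes \<open>H\<close> open at 0; the left
    inverse serves for the lower bound \<open>low\<close>.\<close>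
  have int: "H 0 \<in> interior (H ` ball 0 e)" if "e > 0" "e \<le> \<delta>" for e
    by (rule sussmann_open_mapping[OF open_ball cont _ H G(1,2)]) (use that d in auto)
  from int[OF d order_refl] show "H 0 \<in> interior (H ` ball 0 \<delta>)" .
  obtain N where N: "N > 0" "\<And>v. norm (G' v) \<le> norm v * N"
    using bounded_linear.pos_bounded[OF G(1)] by blast
  \<comment> \<open>With the error rate 1/(2N), |t| \<le> N |H' t| \<le> N |H t - H 0| + |t|/2, and
    the last term is absorbed on the left.\<close>
  obtain d where d1: "d > 0" "\<And>t. norm t < d \<Longrightarrow> norm (H t - H 0 - H' t) \<le> 1 / (2 * N) * norm t"
  proof -
    have "1 / (2 * N) > 0" using N(1) by simp
    then show ?thesis using H that unfolding has_derivative_at_alt by (metis diff_zero)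
  qed
  have low: "norm t \<le> 2 * N * norm (H t - H 0)" if "norm t < d" for t
  proof -
    have "norm t \<le> norm (H' t) * N" using N(2)[of "H' t"] fun_cong[OF G(3), of t] by simp
    also have "\<dots> \<le> (norm (H t - H 0) + 1 / (2 * N) * norm t) * N"
      using d1(2)[OF that] norm_triangle_sub[of "H' t" "H t - H 0"] N(1)
      by (intro mult_right_mono) (auto simp: norm_minus_commute)
    finally show ?thesis using N(1) by (simp add: field_simps)
  qed
  define e where "e = min d \<delta>"
  have e: "e > 0" "e \<le> \<delta>" "e \<le> d" using d d1 by (auto simp: e_def)
  define W where "W = H ` ball 0 e"
  define g where "g \<sigma> = (SOME t. t \<in> ball 0 e \<and> H t = \<sigma>)" for \<sigma>
  have g: "g \<sigma> \<in> ball 0 e" "H (g \<sigma>) = \<sigma>" if "\<sigma> \<in> W" for \<sigma>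
  proof -
    have "\<exists>t. t \<in> ball 0 e \<and> H t = \<sigma>" using that by (auto simp: W_def)
    from someI_ex[OF this] show "g \<sigma> \<in> ball 0 e" "H (g \<sigma>) = \<sigma>" by (simp_all only: g_def)
  qed
  have gb: "norm (g \<sigma>) \<le> 2 * N * norm (\<sigma> - H 0)" if "\<sigma> \<in> W" for \<sigma>
    using low[of "g \<sigma>"] g[OF that] e by auto
  have iW: "H 0 \<in> interior W" unfolding W_def by (rule int[OF e(1,2)])
  then have W0: "H 0 \<in> W" using interior_subset by blast
  \<comment> \<open>At \<sigma> = H 0 the lower bound forces the chosen preimage to be 0.\<close>
  have g0: "g (H 0) = 0" using gb[OF W0] by simp
  have "(g \<longlongrightarrow> 0) (at (H 0))"
  proof (rule Lim_null_comparison)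
    show "\<forall>\<^sub>F \<sigma> in at (H 0). norm (g \<sigma>) \<le> 2 * N * norm (\<sigma> - H 0)"
      using eventually_at_in_open'[OF open_interior iW]
      by eventually_elim (use gb interior_subset in blast)
    have "((\<lambda>\<sigma>. \<sigma> - H 0) \<longlongrightarrow> H 0 - H 0) (at (H 0))" by (intro tendsto_intros)
    then show "((\<lambda>\<sigma>. 2 * N * norm (\<sigma> - H 0)) \<longlongrightarrow> 0) (at (H 0))"
      by (intro tendsto_mult_right_zero tendsto_norm_zero) simp
  qed
  then have gc: "continuous (at (H 0)) g" by (simp add: continuous_at g0)
  have gD: "(g has_derivative G') (at (H 0))"
  proof (rule has_derivative_inverse_basic[OF _ G(1,3) gc open_interior iW])
    show "(H has_derivative H') (at (g (H 0)))" using H by (simp add: g0)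
    show "H (g z) = z" if "z \<in> interior W" for z
      using that interior_subset by (intro g) blast
  qed
  have "((\<lambda>\<sigma>. h (g \<sigma>)) has_derivative (\<lambda>v. h' (G' v))) (at (H 0))"
    using has_derivative_compose[OF gD, of h h'] h by (simp add: g0)
  then show "(F has_derivative (\<lambda>v. h' (G' v))) (at (H 0))"
  proof (rule has_derivative_transform_within_open[OF _ open_interior iW])
    fix \<sigma> assume "\<sigma> \<in> interior W"
    then have "\<sigma> \<in> W" using interior_subset by blast
    from g[OF this] e F[of "g \<sigma>"] show "h (g \<sigma>) = F \<sigma>" by auto
  qed
qed

section \<open>Complete observables\<close>

text \<open>Regularity of \<Psi> is stated through \<open>g \<circ> \<Psi>\<close> for smooth
  \<open>g\<close>, the form in which the clocks and the observable use it. In a chart around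
  \<open>y\<close>, \<Psi> is the composition of the local flows of all constraints.\<close>

lemma gauge_orbit_parametrization:
  fixes \<A> :: "('a::{t2_space,second_countable_topology}, 'e::euclidean_space) atlas"
    and C :: "'n::finite \<Rightarrow> 'a \<Rightarrow> real"
  assumes A: "smooth_atlas \<A>" and pb: "poisson_bracket \<A> pb" and C: "\<And>i. smooth_fun \<A> (C i)"
    and y: "y \<in> gauge_orbit \<A> pb C x"
  obtains \<delta> and \<Psi> :: "real ^ 'n \<Rightarrow> 'a" where "\<delta> > 0" "\<Psi> 0 = y"
    "\<And>t. t \<in> ball 0 \<delta> \<Longrightarrow> \<Psi> t \<in> gauge_orbit \<A> pb C x"
    "\<And>g. smooth_fun \<A> g \<Longrightarrow> continuous_on (ball 0 \<delta>) (\<lambda>t. g (\<Psi> t))"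
    "\<And>g. smooth_fun \<A> g \<Longrightarrow>
      ((\<lambda>t. g (\<Psi> t)) has_derivative (\<lambda>t. \<Sum>k\<in>UNIV. t $ k * pb (C k) g y)) (at 0)"
proof -
  have "y \<in> (\<Union>(U, \<phi>)\<in>\<A>. U)" using A by (simp add: smooth_atlas_def)
  then obtain U \<phi> where U: "(U, \<phi>) \<in> \<A>" "y \<in> U" by auto
  note cU = chartD[OF atlas_chart[OF A U(1)]]
  let ?i = "inv_into U \<phi>"
  define x0 where "x0 = \<phi> y"
  have ix: "?i x0 = y" unfolding x0_def by (rule cU(6)[OF U(2)])
  obtain R where R: "ball x0 R \<subseteq> \<phi> ` U" "R > 0"
    using cU(2) U(2) unfolding x0_def open_contains_ball by blast
  let ?P = "\<lambda>k a u v. a > 0 \<and> continuous_on ({-a..a} \<times> UNIV) (\<lambda>(t, z). u t z) \<and> u 0 x0 = x0 \<and>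
    ((\<lambda>(t, z). u t z) has_derivative (\<lambda>(s, w). w + s *\<^sub>R v)) (at (0, x0)) \<and>
    (\<forall>f. smooth_fun \<A> f \<longrightarrow> pb (C k) f (?i x0) = frechet_derivative (\<lambda>x. f (?i x)) (at x0) v) \<and>
    (\<forall>t z. \<bar>t\<bar> \<le> a \<longrightarrow> z \<in> ball x0 (R / 8) \<longrightarrow> flow_to \<A> pb (C k) t (?i z) (?i (u t z)))"
  have "\<exists>a u v. ?P k a u v" for k
    by (rule bracket_local_flow[OF A pb C U(1) R, of k]) blast
  then obtain a u v where P: "\<And>k. ?P k (a k) (u k) (v k)" by metis
  \<comment> \<open>Finitely many constraints admit a common positive flow time.\<close>
  define a0 where "a0 = Min (range a)"
  have a0: "a0 > 0" "a0 \<le> a k" for k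
    using P by (simp_all add: a0_def)
  have cont: "continuous_on ({-a0..a0} \<times> UNIV) (\<lambda>(t, z). u k t z)" for k
  proof (rule continuous_on_subset)
    show "continuous_on ({-a k..a k} \<times> UNIV) (\<lambda>(t, z). u k t z)" using P by blast
  qed (use a0(2)[of k] in auto)
  have zero: "u k 0 x0 = x0"
    and der: "((\<lambda>(t, z). u k t z) has_derivative (\<lambda>(s, w). w + s *\<^sub>R v k)) (at (0, x0))" for k
    using P by blast+
  note cf = compose_flows[of a0 u x0 v, OF cont zero der]
  have ev: "\<forall>\<^sub>F t in nhds 0. compose_flows u x0 ks t \<in> ball x0 (R / 8)" for ks
  proof -
    have "(compose_flows u x0 ks \<longlongrightarrow> compose_flows u x0 ks 0) (nhds 0)"
      using has_derivative_continuous[OF cf(3)]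
      by (simp add: continuous_at tendsto_at_iff_tendsto_nhds)
    then show ?thesis
      by (rule topological_tendstoD) (use R(2) in \<open>auto simp: cf(1)\<close>)
  qed
  \<comment> \<open>The next flow is realised on the manifold only from points within
    \<open>R / 8\<close> of \<open>x0\<close>. By \<open>ev\<close> each partial composition is such
    a point for small \<open>t\<close>, so one more flow stays in the orbit.\<close>
  have orbit: "\<forall>\<^sub>F t in nhds 0. ?i (compose_flows u x0 ks t) \<in> gauge_orbit \<A> pb C x" for ks
  proof (induction ks)
    case Nil
    then show ?case using y by (simp add: compose_flows_simps ix)
  next
    case (Cons k ks)
    have "\<forall>\<^sub>F t in nhds 0. t \<in> ball (0 :: real ^ 'n) a0"
      by (rule eventually_nhds_in_open) (use a0 in auto)
    with Cons.IH ev[of ks] show ?case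
    proof eventually_elim
      case (elim t)
      have "\<bar>t $ k\<bar> \<le> a k" using elim(3) component_le_norm_cart[of t k] a0(2)[of k] by auto
      then have "flow_to \<A> pb (C k) (t $ k) (?i (compose_flows u x0 ks t))
          (?i (u k (t $ k) (compose_flows u x0 ks t)))"
        using P elim(2) by blast
      from gauge_orbit.flow[OF elim(1) this] show ?case by (simp add: compose_flows_simps)
    qed
  qed
  \<comment> \<open>Any enumeration of the constraints serves; distinctness turns the list sum into
    the sum over all indices.\<close>
  obtain ks :: "'n list" where ks: "set ks = UNIV" "distinct ks"
    using finite_distinct_list[OF finite] by blast
  let ?\<Phi> = "compose_flows u x0 ks"
  have "\<forall>\<^sub>F t in nhds 0. ?i (?\<Phi> t) \<in> gauge_orbit \<A> pb C x \<and> ?\<Phi> t \<in> ball x0 (R / 8)"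
    using orbit[of ks] ev[of ks] by (rule eventually_conj)
  then obtain d where d: "d > 0" "\<And>t. t \<in> ball 0 d \<Longrightarrow> ?i (?\<Phi> t) \<in> gauge_orbit \<A> pb C x"
    "\<And>t. t \<in> ball 0 d \<Longrightarrow> ?\<Phi> t \<in> ball x0 (R / 8)"
    by (auto simp: eventually_nhds_metric dist_commute)
  show ?thesis
  proof (rule that[of "min d a0" "\<lambda>t. ?i (?\<Phi> t)"])
    show "min d a0 > 0" using d a0 by simp
    show "?i (?\<Phi> 0) = y" by (simp add: cf(1) ix)
    show "?i (?\<Phi> t) \<in> gauge_orbit \<A> pb C x" if "t \<in> ball 0 (min d a0)" for t
      using that by (intro d(2)) simp
    fix g assume g: "smooth_fun \<A> g"
    have "ball x0 (R / 8) \<subseteq> ball x0 R" using R(2) by auto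
    then have "?\<Phi> ` ball 0 (min d a0) \<subseteq> \<phi> ` U"
      using d(3) R(1) by (fastforce simp: image_subset_iff)
    moreover have "continuous_on (ball 0 (min d a0)) ?\<Phi>"
      by (rule continuous_on_subset[OF cf(2)]) auto
    ultimately show "continuous_on (ball 0 (min d a0)) (\<lambda>t. g (?i (?\<Phi> t)))"
      by (intro continuous_on_compose2[OF Ck_on_continuous_on[OF smooth_fun_Ck_on[OF A g U(1), of 0]]])
    let ?D = "frechet_derivative (\<lambda>x. g (?i x)) (at x0)"
    have D: "((\<lambda>x. g (?i x)) has_derivative ?D) (at x0)"
      using Ck_on_Suc_has_derivative[OF smooth_fun_Ck_on[OF A g U(1)]] U(2) by (auto simp: x0_def)
    have "((\<lambda>t. g (?i (?\<Phi> t))) has_derivative (\<lambda>t. ?D (\<Sum>k\<leftarrow>ks. t $ k *\<^sub>R v k))) (at 0)"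
      using has_derivative_compose[OF cf(3)] D by (simp add: cf(1))
    moreover have "?D (\<Sum>k\<leftarrow>ks. t $ k *\<^sub>R v k) = (\<Sum>k\<in>UNIV. t $ k * pb (C k) g y)" for t
    proof -
      have "pb (C k) g y = ?D (v k)" for k using P g by (simp add: ix)
      then show ?thesis
        using has_derivative_linear[OF D]
        by (simp add: sum_list_distinct_conv_sum_set[OF ks(2)] ks(1) linear_sum linear_scale)
    qed
    ultimately show "((\<lambda>t. g (?i (?\<Phi> t))) has_derivative (\<lambda>t. \<Sum>k\<in>UNIV. t $ k * pb (C k) g y)) (at 0)"
      by simp
  qed
qed

text \<open>Injectivity of the clocks makes the definite description pick \<open>y\<close>. Applied
  to \<open>f\<close> and also to \<open>observable_rate\<close>.\<close>

lemma complete_observable_eq: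
  assumes "inj_on (clock_map T) (gauge_orbit \<A> pb C x)" "y \<in> gauge_orbit \<A> pb C x"
  shows "complete_observable \<A> pb C g T (clock_map T y) x = g y"
proof -
  have "(THE z. z \<in> gauge_orbit \<A> pb C x \<and> (\<forall>i. T i z = clock_map T y $ i)) = y"
  proof (rule the_equality)
    fix z assume z: "z \<in> gauge_orbit \<A> pb C x \<and> (\<forall>i. T i z = clock_map T y $ i)"
    then have "clock_map T z = clock_map T y" by (simp add: clock_map_def vec_eq_iff)
    then show "z = y" using inj_onD[OF assms(1)] z assms(2) by blast
  qed (use assms(2) in \<open>simp add: clock_map_def\<close>)
  then show ?thesis by (simp add: complete_observable_def)
qed

lemma has_partial_derivativeI:
  fixes F :: "real ^ 'n::finite \<Rightarrow> real"
  assumes "\<tau> \<in> interior D" "(F has_derivative F') (at \<tau>)"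
  shows "has_partial_derivative F D m (F' (axis m 1)) \<tau>"
  unfolding has_partial_derivative_def
proof
  let ?l = "\<lambda>s. \<tau> + s *\<^sub>R axis m 1"
  have "(?l \<longlongrightarrow> ?l 0) (nhds 0)" by (intro tendsto_intros filterlim_ident)
  then have "\<forall>\<^sub>F s in nhds 0. ?l s \<in> interior D"
    by (rule topological_tendstoD) (use assms(1) in auto)
  then show "\<forall>\<^sub>F s in nhds 0. ?l s \<in> D"
    by eventually_elim (use interior_subset in blast)
  have "(?l has_derivative (\<lambda>s. s *\<^sub>R axis m 1)) (at 0)"
    by (auto intro!: derivative_eq_intros)
  then have "((\<lambda>s. F (?l s)) has_derivative (\<lambda>s. F' (s *\<^sub>R axis m 1))) (at 0)"
    by (rule has_derivative_compose) (use assms(2) in simp)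
  then show "((\<lambda>s. F (?l s)) has_real_derivative F' (axis m 1)) (at 0)"
    unfolding has_field_derivative_def
    by (rule has_derivative_eq_rhs)
      (simp add: fun_eq_iff linear_scale[OF has_derivative_linear[OF assms(2)]])
qed

lemma complete_observable_has_partial_derivative:
  fixes \<A> :: "('a::{t2_space,second_countable_topology}, 'e::euclidean_space) atlas"
    and C T :: "'n::finite \<Rightarrow> 'a \<Rightarrow> real"
  assumes A: "smooth_atlas \<A>" and pb: "poisson_bracket \<A> pb" and C: "\<And>i. smooth_fun \<A> (C i)"
    and T: "\<And>i. smooth_fun \<A> (T i)" and f: "smooth_fun \<A> f"
    and inj: "inj_on (clock_map T) (gauge_orbit \<A> pb C x)"
    and y: "y \<in> gauge_orbit \<A> pb C x" and inv: "invertible (clock_matrix pb C T y)"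
  shows "has_partial_derivative (\<lambda>\<sigma>. complete_observable \<A> pb C f T \<sigma> x)
    (clock_map T ` gauge_orbit \<A> pb C x) m (observable_rate pb C T f m y) (clock_map T y)"
proof -
  let ?M = "clock_matrix pb C T y"
  obtain \<delta> and \<Psi> :: "real ^ 'n \<Rightarrow> 'a" where \<delta>: "\<delta> > 0" and \<Psi>: "\<Psi> 0 = y"
    "\<And>t. t \<in> ball 0 \<delta> \<Longrightarrow> \<Psi> t \<in> gauge_orbit \<A> pb C x"
    "\<And>g. smooth_fun \<A> g \<Longrightarrow> continuous_on (ball 0 \<delta>) (\<lambda>t. g (\<Psi> t))"
    "\<And>g. smooth_fun \<A> g \<Longrightarrow>
      ((\<lambda>t. g (\<Psi> t)) has_derivative (\<lambda>t. \<Sum>k\<in>UNIV. t $ k * pb (C k) g y)) (at 0)"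
    by (rule gauge_orbit_parametrization[OF A pb C y], rule that)
  have M: "?M ** matrix_inv ?M = mat 1" "matrix_inv ?M ** ?M = mat 1"
    using someI_ex[OF inv[unfolded invertible_def]] by (auto simp: matrix_inv_def)
  \<comment> \<open>Since the constraint index of the matrix comes first, flow times act as row
    vectors: the j-th component of the derivative is the sum of t_k {C_k, T_j}(y) over k.\<close>
  let ?H = "\<lambda>t. clock_map T (\<Psi> t)" and ?H' = "\<lambda>t. t v* ?M" and ?G' = "\<lambda>s. s v* matrix_inv ?M"
  have Hc: "continuous_on (ball 0 \<delta>) ?H"
    unfolding clock_map_def by (intro continuous_on_vec_lambda \<Psi>(3) T)
  have HD: "(?H has_derivative ?H') (at 0)"
  proof (subst has_derivative_componentwise_within, intro ballI)
    fix b :: "real ^ 'n" assume "b \<in> Basis"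
    then obtain j where b: "b = axis j 1" by (auto simp: Basis_vec_def)
    show "((\<lambda>t. ?H t \<bullet> b) has_derivative (\<lambda>t. ?H' t \<bullet> b)) (at 0)"
      using \<Psi>(4)[OF T[of j]]
      by (simp add: b inner_axis clock_map_def clock_matrix_def vector_matrix_mult_def mult.commute)
  qed
  have "bounded_linear (\<lambda>s. transpose (matrix_inv ?M) *v s)"
    by (rule matrix_vector_mul_bounded_linear)
  then have G: "bounded_linear ?G'" "?H' \<circ> ?G' = id" "?G' \<circ> ?H' = id"
    by (simp_all add: fun_eq_iff vector_matrix_mul_assoc M)
  have F: "complete_observable \<A> pb C f T (?H t) x = f (\<Psi> t)" if "t \<in> ball 0 \<delta>" for t
    by (rule complete_observable_eq[OF inj \<Psi>(2)[OF that]])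
  \<comment> \<open>Here \<open>H\<close> is the clock map along \<Psi> and \<open>h\<close> is
    \<open>f \<circ> \<Psi>\<close>; \<open>F\<close> factors \<open>h\<close> through
    \<open>H\<close>.\<close>
  note inverse = has_derivative_local_inverse[where F = "\<lambda>\<sigma>. complete_observable \<A> pb C f T \<sigma> x",
      OF \<delta> Hc HD \<Psi>(4)[OF f] G F]
  have "?H ` ball 0 \<delta> \<subseteq> clock_map T ` gauge_orbit \<A> pb C x" using \<Psi>(2) by blast
  from has_partial_derivativeI[OF subsetD[OF interior_mono[OF this] inverse(1)] inverse(2), of m]
  have "has_partial_derivative (\<lambda>\<sigma>. complete_observable \<A> pb C f T \<sigma> x)
    (clock_map T ` gauge_orbit \<A> pb C x) m
    (\<Sum>k\<in>UNIV. (axis m 1 v* matrix_inv ?M) $ k * pb (C k) f y) (clock_map T y)"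
    by (simp add: \<Psi>(1))
  \<comment> \<open>Multiplying the m-th unit row vector by the inverse matrix selects its m-th row,
    the coefficients of \<open>observable_rate\<close>.\<close>
  moreover have "(axis m 1 v* matrix_inv ?M) $ k = matrix_inv ?M $ m $ k" for k
    by (simp add: vector_matrix_mult_def axis_def mult_if_delta)
  ultimately show ?thesis by (simp add: observable_rate_def)
qed

theorem mainTheorem3:
  fixes \<A> :: "('a::{t2_space,second_countable_topology}, 'e::euclidean_space) atlas"
    and pb :: "'a bracket"
    and C T :: "'n::finite \<Rightarrow> 'a \<Rightarrow> real"
    and f :: "'a \<Rightarrow> real"
    and x :: 'a
    and p :: nat
  assumes "smooth_atlas \<A>"
    and "DIM('e) = 2 * p"
    and "poisson_bracket \<A> pb"
    and "nondegenerate \<A> pb"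
    and "CARD('n) < p"
    and "\<And>i. smooth_fun \<A> (C i)"
    and "independent_constraints \<A> C"
    and "first_class \<A> pb C"
    and "x \<in> constraint_surface C"
    and "\<And>i. smooth_fun \<A> (T i)"
    and "smooth_fun \<A> f"
    and "inj_on (clock_map T) (gauge_orbit \<A> pb C x)"
    and "\<And>y. y \<in> gauge_orbit \<A> pb C x \<Longrightarrow> invertible (clock_matrix pb C T y)"
  shows "\<forall>\<tau> \<in> clock_map T ` gauge_orbit \<A> pb C x. \<forall>m.
      complete_observable \<A> pb C f T \<tau> x = f (clock_inverse \<A> pb C T x \<tau>) \<and>
      has_partial_derivative (\<lambda>\<sigma>. complete_observable \<A> pb C f T \<sigma> x)
        (clock_map T ` gauge_orbit \<A> pb C x) m
        (observable_rate pb C T f m (clock_inverse \<A> pb C T x \<tau>)) \<tau> \<and>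
      observable_rate pb C T f m (clock_inverse \<A> pb C T x \<tau>) =
        complete_observable \<A> pb C (observable_rate pb C T f m) T \<tau> x"
proof (intro ballI allI)
  fix \<tau> m assume "\<tau> \<in> clock_map T ` gauge_orbit \<A> pb C x"
  then obtain y where y: "y \<in> gauge_orbit \<A> pb C x" "\<tau> = clock_map T y" by blast
  \<comment> \<open>With \<tau> written as the clock value of an orbit point \<open>y\<close>, the
    inverse returns \<open>y\<close>, and each complete observable at \<tau> is a value at
    \<open>y\<close>.\<close>
  have "clock_inverse \<A> pb C T x \<tau> = y"
    unfolding clock_inverse_def y(2) by (rule inv_into_f_f[OF assms(12) y(1)])
  then show "complete_observable \<A> pb C f T \<tau> x = f (clock_inverse \<A> pb C T x \<tau>) \<and>
      has_partial_derivative (\<lambda>\<sigma>. complete_observable \<A> pb C f T \<sigma> x)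
        (clock_map T ` gauge_orbit \<A> pb C x) m
        (observable_rate pb C T f m (clock_inverse \<A> pb C T x \<tau>)) \<tau> \<and>
      observable_rate pb C T f m (clock_inverse \<A> pb C T x \<tau>) =
        complete_observable \<A> pb C (observable_rate pb C T f m) T \<tau> x"
    using complete_observable_has_partial_derivative[OF assms(1,3,6,10,11,12) y(1) assms(13)[OF y(1)], of m]
    by (simp add: y(2) complete_observable_eq[OF assms(12) y(1)])
qed

end
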